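(* Let a natural general-form Heun equation of the canonical type $$\frac{d^2u}{ds^2}+\left(\frac\gamma{s-d_1}+\frac\delta{s-d_2}+\frac\epsilon{s-d_3}\right)\frac{du}{ds}+\frac{\alpha\beta s-q'}{(s-d_1)(s-d_2)(s-d_3)}\,u=0$$ be given, with $d_1,d_2,d_3\in\mathbb C$ distinct and $\alpha+\beta-\gamma-\delta-\epsilon+1=0$, which has four singular points and is nontrivial (i.e. $\alpha\beta\ne0$ or $q'\neq0$). It can be reduced to a hypergeometric equation $(\mathfrak h)$ by a rational substitution $z=R(s)$ if and only if $\alpha\beta\neq0$, $R$ is a polynomial, and the equation satisfies the following conditions. (i) $\triangle d_1d_2d_3$ is similar to $\triangle01D$ with $D=2$ or $\frac12+\mathrm i\frac{\sqrt3}2$, or $D=4$, $\frac12+\mathrm i\frac{5\sqrt2}4$, or $\frac12+\mathrm i\frac{11\sqrt{15}}{90}$; that is, it is either a degenerate triangle consisting of three equally spaced collinear points (the harmonic case), or an equilateral triangle (the equianharmonic case), or similar to one of three other specified triangles, of which one is degenerate and two are isosceles. (ii) For some complex affine map $B$ with $B(\{d_1,d_2,d_3\})=\{0,1,D\}$, the exponent parameters $\gamma,\delta,\epsilon$ satisfy the conditions of a subcase (1a)--(2d) with this $D$ in the list given in the context. (iii) The parameter $q'$ takes the value $q'=\alpha\beta\,B^{-1}(p_0)$, with $p_0$ as listed in that subcase.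
   Context: The hypergeometric equation $(\mathfrak h)$ with parameters $a,b,c\in\mathbb C$ is $$\frac{d^2y}{dz^2}+\left(\frac cz+\frac{a+b-c+1}{z-1}\right)\frac{dy}{dz}+\frac{ab}{z(z-1)}\,y=0 .$$ A second-order equation in $s$ is reduced to a hypergeometric equation by $z=R(s)$, with $R$ a nonconstant rational function, if substituting $z=R(s)$ in $(\mathfrak h)$ for some $a,b,c$, without change of the dependent variable, yields exactly the given equation. The equation of the claim has characteristic exponents $0,1-\gamma$ at $d_1$; $0,1-\delta$ at $d_2$; $0,1-\epsilon$ at $d_3$; $\alpha,\beta$ at $\infty$; it has four singular points if each of $d_1,d_2,d_3,\infty$ is genuinely a singular point. Triangles are similar if a complex affine map $s\mapsto ms+n$, $m\neq0$, takes the vertex set of one onto that of the other; degenerate triangles are allowed. The exponent parameters $\gamma,\delta,\epsilon$ belong to $d_1,d_2,d_3$ respectively. For $x\in\{0,1,D\}$, $\kappa_x$ denotes the exponent parameter belonging to $B^{-1}(x)$. The subcases are: (1a) $D=2$, $p_0=1$, $\kappa_0=\kappa_2$, with $P(t)=t(2-t)$. (1b) $D=4$, $p_0=1$, $1-\kappa_1=2(1-\kappa_4)$, $\kappa_0=\frac12$, with $P(t)=(t-1)^2(1-t/4)$. (1c) $D=2$, $p_0=1$, $\kappa_0=\kappa_2$, $1-\kappa_1=2(1-\kappa_0)$, with $P(t)=4[t(2-t)-\frac12]^2$. (2a) $D=\frac12+\mathrm i\frac{\sqrt3}2$, $p_0=\frac12+\mathrm i\frac{\sqrt3}6$, $\gamma=\delta=\epsilon$,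 with $P(t)=[1-t/p_0]^3$. (2b) $D=\frac12+\mathrm i\frac{5\sqrt2}4$, $p_0=\frac12+\mathrm i\frac{\sqrt2}4$, $\kappa_D=\frac23$, $\kappa_0=\kappa_1=\frac12$, with $P(t)=[1-t/D][1-t/p_0]^3$. (2c) $D=\frac12+\mathrm i\frac{11\sqrt{15}}{90}$, $p_0=\frac12+\mathrm i\frac{\sqrt{15}}{18}$, $\kappa_D=\frac12$, $\kappa_0=\kappa_1=\frac23$, with $P(t)=-\mathrm i\frac{2025\sqrt{15}}{64}\,t(t-1)[t-p_0]^3$. (2d) $D=\frac12+\mathrm i\frac{\sqrt3}2$, $p_0=\frac12+\mathrm i\frac{\sqrt3}6$, $\gamma=\delta=\epsilon=\frac23$, with $P(t)=4\{[1-t/p_0]^3-\frac12\}^2$. The statement is to be read existentially in $R$: a reducing rational substitution exists iff $\alpha\beta\ne0$ and (i)--(iii) hold, and any reducing $R$ is a polynomial, the polynomial transformation being $R=P\circ B$ or $1-P\circ B$ with $P$ as listed in the subcase. *)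

theory Defs
  imports "HOL-Complex_Analysis.Complex_Analysis" "HOL-Computational_Algebra.Polynomial"
begin

text \<open>A pair \<open>(p, q)\<close> stands for the equation \<open>y'' + p y' + q y = 0\<close>. The coefficients are
  rational functions, so their values at the (finitely many) poles carry no meaning.\<close>

type_synonym ode = "(complex \<Rightarrow> complex) \<times> (complex \<Rightarrow> complex)"

definition ode_lhs :: "ode \<Rightarrow> (complex \<Rightarrow> complex) \<Rightarrow> complex \<Rightarrow> complex" where
  "ode_lhs E y z = deriv (deriv y) z + fst E z * deriv y z + snd E z * y z"

definition same_ode :: "ode \<Rightarrow> ode \<Rightarrow> bool" where
  "same_ode E F \<longleftrightarrow> (\<forall>\<^sub>F s in cofinite. fst E s = fst F s \<and> snd E s = snd F s)"

definition hypergeom_ode :: "complex \<Rightarrow> complex \<Rightarrow> complex \<Rightarrow> ode" where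
  "hypergeom_ode a b c =
     (\<lambda>z. c / z + (a + b - c + 1) / (z - 1),
      \<lambda>z. a * b / (z * (z - 1)))"

definition heun_ode ::
  "complex \<Rightarrow> complex \<Rightarrow> complex \<Rightarrow> complex \<Rightarrow> complex \<Rightarrow> complex \<Rightarrow> complex \<Rightarrow> complex \<Rightarrow> complex \<Rightarrow> ode" where
  "heun_ode d1 d2 d3 \<gamma> \<delta> \<epsilon> \<alpha> \<beta> q' =
     (\<lambda>s. \<gamma> / (s - d1) + \<delta> / (s - d2) + \<epsilon> / (s - d3),
      \<lambda>s. (\<alpha> * \<beta> * s - q') / ((s - d1) * (s - d2) * (s - d3)))"

text \<open>The equation for \<open>u(s) = y(R(s))\<close> obtained from the equation \<open>E\<close> for \<open>y(z)\<close> by substituting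
  \<open>z = R(s)\<close> and normalizing the leading coefficient to 1; see \<open>ode_lhs_subst\<close> below.\<close>

definition ode_subst :: "(complex \<Rightarrow> complex) \<Rightarrow> ode \<Rightarrow> ode" where
  "ode_subst R E =
     (\<lambda>s. fst E (R s) * deriv R s - deriv (deriv R) s / deriv R s,
      \<lambda>s. snd E (R s) * (deriv R s)\<^sup>2)"

lemma ode_lhs_subst:
  assumes R: "R analytic_on {s}" and y: "y analytic_on {R s}" and nz: "deriv R s \<noteq> 0"
  shows "ode_lhs (ode_subst R E) (y \<circ> R) s = (deriv R s)\<^sup>2 * ode_lhs E y (R s)"
proof -
  have evR: "\<forall>\<^sub>F t in nhds s. R analytic_on {t}"
    using R by (simp add: analytic_at eventually_nhds) (metis analytic_at)
  have evy: "\<forall>\<^sub>F w in nhds (R s). y analytic_on {w}"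
    using y by (simp add: analytic_at eventually_nhds) (metis analytic_at)
  have "isCont R s"
    using R analytic_at_imp_isCont by blast
  hence lim: "filterlim R (nhds (R s)) (nhds s)"
    by (simp add: continuous_at tendsto_nhds_iff)
  have ev: "\<forall>\<^sub>F t in nhds s. deriv (y \<circ> R) t = deriv y (R t) * deriv R t"
    using evR eventually_compose_filterlim[OF evy lim]
    by eventually_elim (rule deriv_chain; simp add: analytic_on_imp_differentiable_at)
  have dR: "R field_differentiable at s"
    using R by (simp add: analytic_on_imp_differentiable_at)
  have ddR: "deriv R field_differentiable at s"
    using R analytic_deriv analytic_on_imp_differentiable_at by blast
  have ddy: "deriv y field_differentiable at (R s)"
    using y analytic_deriv analytic_on_imp_differentiable_at by blast
  have 1: "((\<lambda>t. deriv y (R t)) has_field_derivative deriv (deriv y) (R s) * deriv R s) (at s)"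
    using DERIV_chain2[OF ddy[THEN field_differentiable_derivI] dR[THEN field_differentiable_derivI]] .
  have "((\<lambda>t. deriv y (R t) * deriv R t) has_field_derivative
          deriv (deriv y) (R s) * deriv R s * deriv R s + deriv (deriv R) s * deriv y (R s)) (at s)"
    using DERIV_mult[OF 1 ddR[THEN field_differentiable_derivI]] .
  hence 2: "deriv (deriv (y \<circ> R)) s =
      deriv (deriv y) (R s) * deriv R s * deriv R s + deriv (deriv R) s * deriv y (R s)"
    using deriv_cong_ev[OF ev refl] DERIV_imp_deriv by simp
  have 3: "deriv (y \<circ> R) s = deriv y (R s) * deriv R s"
    using eventually_nhds_x_imp_x[OF ev] .
  show ?thesis
    using nz by (simp add: ode_lhs_def ode_subst_def 2 3 field_simps power2_eq_square)
qed

definition ordinary_point :: "ode \<Rightarrow> complex \<Rightarrow> bool" where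
  "ordinary_point E d \<longleftrightarrow>
     (\<exists>p q. p analytic_on {d} \<and> q analytic_on {d} \<and>
            (\<forall>\<^sub>F s in at d. fst E s = p s \<and> snd E s = q s))"

definition ordinary_at_infinity :: "ode \<Rightarrow> bool" where
  "ordinary_at_infinity E \<longleftrightarrow> ordinary_point (ode_subst (\<lambda>w. 1 / w) E) 0"

text \<open>Lowest terms matter: otherwise \<open>R\<close> would take the junk value 0 at a cancelling zero of the
  denominator, and could be polynomial as a rational function but not as a function.\<close>

definition rational_fun :: "(complex \<Rightarrow> complex) \<Rightarrow> bool" where
  "rational_fun R \<longleftrightarrow>
     (\<exists>N M :: complex poly. M \<noteq> 0 \<and> coprime N M \<and> R = (\<lambda>s. poly N s / poly M s))"

definition reduces_to_hypergeom :: "ode \<Rightarrow> (complex \<Rightarrow> complex) \<Rightarrow> bool" where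
  "reduces_to_hypergeom E R \<longleftrightarrow>
     rational_fun R \<and> \<not> R constant_on UNIV \<and>
     (\<exists>a b c. same_ode (ode_subst R (hypergeom_ode a b c)) E)"

definition complex_affine :: "(complex \<Rightarrow> complex) \<Rightarrow> bool" where
  "complex_affine B \<longleftrightarrow> (\<exists>m n. m \<noteq> 0 \<and> B = (\<lambda>s. m * s + n))"

definition similar_triangles :: "complex set \<Rightarrow> complex set \<Rightarrow> bool" where
  "similar_triangles T T' \<longleftrightarrow> (\<exists>f. complex_affine f \<and> f ` T = T')"

datatype subcase = Case1a | Case1b | Case1c | Case2a | Case2b | Case2c | Case2d

fun case_D :: "subcase \<Rightarrow> complex" where
  "case_D Case1a = 2"
| "case_D Case1b = 4"
| "case_D Case1c = 2"
| "case_D Case2a = 1/2 + \<i> * (sqrt 3 / 2)"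
| "case_D Case2b = 1/2 + \<i> * (5 * sqrt 2 / 4)"
| "case_D Case2c = 1/2 + \<i> * (11 * sqrt 15 / 90)"
| "case_D Case2d = 1/2 + \<i> * (sqrt 3 / 2)"

fun case_p0 :: "subcase \<Rightarrow> complex" where
  "case_p0 Case1a = 1"
| "case_p0 Case1b = 1"
| "case_p0 Case1c = 1"
| "case_p0 Case2a = 1/2 + \<i> * (sqrt 3 / 6)"
| "case_p0 Case2b = 1/2 + \<i> * (sqrt 2 / 4)"
| "case_p0 Case2c = 1/2 + \<i> * (sqrt 15 / 18)"
| "case_p0 Case2d = 1/2 + \<i> * (sqrt 3 / 6)"

fun case_P :: "subcase \<Rightarrow> complex \<Rightarrow> complex" where
  "case_P Case1a t = t * (2 - t)"
| "case_P Case1b t = (t - 1)^2 * (1 - t / 4)"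
| "case_P Case1c t = 4 * (t * (2 - t) - 1/2)^2"
| "case_P Case2a t = (1 - t / case_p0 Case2a)^3"
| "case_P Case2b t = (1 - t / case_D Case2b) * (1 - t / case_p0 Case2b)^3"
| "case_P Case2c t = - \<i> * (2025 * sqrt 15 / 64) * t * (t - 1) * (t - case_p0 Case2c)^3"
| "case_P Case2d t = 4 * ((1 - t / case_p0 Case2d)^3 - 1/2)^2"

text \<open>\<open>\<kappa> x\<close> is the exponent parameter belonging to the singular point \<open>B\<inverse>(x)\<close>, for
  \<open>x \<in> {0, 1, D}\<close>. Since \<open>B\<close> maps the three points onto \<open>{0, 1, D}\<close>, the condition
  \<open>\<gamma> = \<delta> = \<epsilon>\<close> reads \<open>\<kappa> 0 = \<kappa> 1 = \<kappa> D\<close>.\<close>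

fun case_condition :: "subcase \<Rightarrow> (complex \<Rightarrow> complex) \<Rightarrow> bool" where
  "case_condition Case1a \<kappa> \<longleftrightarrow> \<kappa> 0 = \<kappa> 2"
| "case_condition Case1b \<kappa> \<longleftrightarrow> 1 - \<kappa> 1 = 2 * (1 - \<kappa> 4) \<and> \<kappa> 0 = 1/2"
| "case_condition Case1c \<kappa> \<longleftrightarrow> \<kappa> 0 = \<kappa> 2 \<and> 1 - \<kappa> 1 = 2 * (1 - \<kappa> 0)"
| "case_condition Case2a \<kappa> \<longleftrightarrow> \<kappa> 0 = \<kappa> 1 \<and> \<kappa> 1 = \<kappa> (case_D Case2a)"
| "case_condition Case2b \<kappa> \<longleftrightarrow> \<kappa> (case_D Case2b) = 2/3 \<and> \<kappa> 0 = 1/2 \<and> \<kappa> 1 = 1/2"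
| "case_condition Case2c \<kappa> \<longleftrightarrow> \<kappa> (case_D Case2c) = 1/2 \<and> \<kappa> 0 = 2/3 \<and> \<kappa> 1 = 2/3"
| "case_condition Case2d \<kappa> \<longleftrightarrow> \<kappa> 0 = 2/3 \<and> \<kappa> 1 = 2/3 \<and> \<kappa> (case_D Case2d) = 2/3"

text \<open>The exponent parameter belonging to one of the three distinct points \<open>d1, d2, d3\<close>.\<close>

definition exponent_param ::
  "complex \<Rightarrow> complex \<Rightarrow> complex \<Rightarrow> complex \<Rightarrow> complex \<Rightarrow> complex \<Rightarrow> complex \<Rightarrow> complex" where
  "exponent_param d1 d2 d3 \<gamma> \<delta> \<epsilon> s =
     (if s = d1 then \<gamma> else if s = d2 then \<delta> else if s = d3 then \<epsilon> else undefined)"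

end

theory Submission
  imports Defs "HOL-Computational_Algebra.Computational_Algebra"
begin

text \<open>
  Let \<open>T = (s - d\<^sub>1) (s - d\<^sub>2) (s - d\<^sub>3)\<close>. Comparing the coefficients of \<open>u\<close> gives
  \<open>a b R'\<^sup>2 T = (\<alpha> \<beta> s - q') R (R - 1)\<close>. A pole of \<open>R\<close> would violate this identity because of
  the orders of both sides there, and for a polynomial \<open>R\<close> of degree \<open>n\<close> the degrees force
  \<open>\<alpha> \<beta> = n\<^sup>2 a b \<noteq> 0\<close>. With \<open>q = q' / (\<alpha> \<beta>)\<close>, comparing orders again shows that all
  critical points of \<open>R\<close> lie over 0 and 1, where the multiplicity at a point \<open>z\<close> is
  \<open>2 - [z \<in> {d\<^sub>1, d\<^sub>2, d\<^sub>3}] + [z = q]\<close>. The residues of the coefficients of \<open>u'\<close> then express the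
  exponent parameters by \<open>c\<close> and \<open>c' = a + b - c + 1\<close>, and a double point over 0 (resp. 1) forces
  \<open>c = 1/2\<close> (resp. \<open>c' = 1/2\<close>), which is impossible in the fibre of \<open>q\<close>. If, after replacing \<open>R\<close>
  by \<open>1 - R\<close>, the point \<open>q\<close> lies over 0, this leaves
  \[ R = C \prod_{d \in S_0} (s - d) \cdot (s - q)^m, \quad
     R - 1 = C \prod_{d \in S_1} (s - d) \cdot h^2, \quad \deg h = |S_0|, \]
  with \<open>m = 2\<close> and \<open>|S\<^sub>0| \<le> 2\<close> if \<open>q\<close> is singular, and \<open>m = 3\<close> and \<open>|S\<^sub>0| \<le> 3\<close> otherwise: the seven
  subcases. Comparing coefficients in \<open>s - q\<close> determines each of them up to an affine map.
  Conversely such a factorization forces \<open>R' = K (s - q)\<^bsup>m-1\<^esup> h\<close>, so that \<open>R\<close> does reduce the equation.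
\<close>

section \<open>Polynomials with simple roots and Fuchsian equations\<close>

definition root_poly :: "complex set \<Rightarrow> complex poly" where
  "root_poly S = (\<Prod>d\<in>S. [:-d, 1:])"

text \<open>The Heun equation over an unordered set of singular points, with \<open>k\<close> for
  \<open>\<alpha> * \<beta>\<close>. The exponent parameters form a function on the points, so no
  argument depends on their numbering.\<close>

definition fuchsian_ode ::
  "complex set \<Rightarrow> (complex \<Rightarrow> complex) \<Rightarrow> complex \<Rightarrow> complex \<Rightarrow> ode" where
  "fuchsian_ode S \<kappa> k q' =
     (\<lambda>s. \<Sum>d\<in>S. \<kappa> d / (s - d), \<lambda>s. (k * s - q') / poly (root_poly S) s)"

lemma poly_root_poly: "poly (root_poly S) s = (\<Prod>d\<in>S. s - d)"
  by (simp add: root_poly_def poly_prod)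

lemma root_poly_nz [simp]: "root_poly S \<noteq> 0"
  by (cases "finite S") (auto simp: root_poly_def)

lemma poly_root_poly_eq_0_iff: "finite S \<Longrightarrow> poly (root_poly S) s = 0 \<longleftrightarrow> s \<in> S"
  by (auto simp: poly_root_poly)

lemma degree_root_poly: "finite S \<Longrightarrow> degree (root_poly S) = card S"
  by (simp add: root_poly_def degree_prod_sum_eq)

lemma lead_coeff_root_poly: "lead_coeff (root_poly S) = 1"
  by (simp add: root_poly_def lead_coeff_prod)

lemma order_root_poly: "finite S \<Longrightarrow> order a (root_poly S) = (if a \<in> S then 1 else 0)"
proof (induction S rule: finite_induct)
  case empty
  then show ?case by (simp add: root_poly_def)
next
  case (insert d S)
  have eq: "root_poly (insert d S) = [:-d, 1:] * root_poly S"
    using insert by (simp add: root_poly_def)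
  have "order a (root_poly (insert d S)) = order a [:-d, 1:] + order a (root_poly S)"
    unfolding eq by (rule order_mult) (simp del: mult_pCons_left)
  moreover have "order a [:-d, 1:] = (if a = d then 1 else 0)"
    using order_power_n_n[of d 1] by (auto simp: order_0I)
  ultimately show ?case
    using insert by auto
qed

lemma root_poly_Un:
  "finite S \<Longrightarrow> finite T \<Longrightarrow> S \<inter> T = {} \<Longrightarrow> root_poly (S \<union> T) = root_poly S * root_poly T"
  unfolding root_poly_def by (rule prod.union_disjoint)

subsection \<open>Polynomial identities\<close>

lemma eventually_cofinite_poly_neq_0:
  "(p :: complex poly) \<noteq> 0 \<Longrightarrow> \<forall>\<^sub>F s in cofinite. poly p s \<noteq> 0"
  by (simp add: eventually_cofinite poly_roots_finite)

lemma poly_eqI_pointwise: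
  fixes p q :: "complex poly"
  assumes "\<And>u. poly p u = poly q u"
  shows "p = q"
  using assms poly_eq_poly_eq_iff by blast

text \<open>A nonzero difference has finitely many roots, but the plane is infinite. Equality of
  equations ignores finitely many points; this turns it into identities of polynomials.\<close>

lemma poly_eqI_cofinite:
  fixes p q :: "complex poly"
  assumes "\<forall>\<^sub>F s in cofinite. poly p s = poly q s"
  shows "p = q"
proof (rule ccontr)
  assume "p \<noteq> q"
  hence "\<forall>\<^sub>F s in cofinite. poly (p - q) s \<noteq> 0"
    by (intro eventually_cofinite_poly_neq_0) simp
  with assms have "\<forall>\<^sub>F s::complex in cofinite. False"
    by eventually_elim simp
  thus False by (simp add: eventually_cofinite infinite_UNIV_char_0)
qed

lemma eventually_at_if_cofinite:
  fixes a :: "'a :: t1_space"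
  assumes "\<forall>\<^sub>F s in cofinite. P s"
  shows "\<forall>\<^sub>F s in at a. P s"
proof -
  have "finite {s. \<not> P s}" using assms by (simp add: eventually_cofinite)
  hence "open (- ({s. \<not> P s} - {a}))" by (intro open_Compl finite_imp_closed finite_Diff)
  thus ?thesis by (auto simp: eventually_at_topological)
qed

lemma deriv_poly: "deriv (poly p) = poly (pderiv p)"
  by (rule ext) (simp add: DERIV_imp_deriv)

text \<open>With \<open>p = (s - a)^m q\<close> and \<open>q\<close> nonzero at \<open>a\<close>,
  the product is \<open>m + (s - a) q'/q\<close>. The case \<open>m = 0\<close> is included, so
  residues can be read off at every point, root or not.\<close>

lemma tendsto_log_deriv_poly:
  fixes p :: "complex poly"
  assumes "p \<noteq> 0"
  shows "((\<lambda>s. (s - a) * (poly (pderiv p) s / poly p s)) \<longlongrightarrow> of_nat (order a p)) (at a)"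
proof -
  obtain q where q: "p = [:-a, 1:] ^ order a p * q" "\<not> [:-a, 1:] dvd q"
    using order_decomp[OF assms] by blast
  define m where "m = order a p"
  have pq: "p = [:-a, 1:] ^ m * q" using q m_def by simp
  have qa: "poly q a \<noteq> 0" using q(2) by (simp add: poly_eq_0_iff_dvd)
  have "((\<lambda>s. of_nat m + (s - a) * (poly (pderiv q) s / poly q s)) \<longlongrightarrow>
          of_nat m + (a - a) * (poly (pderiv q) a / poly q a)) (at a)"
    by (intro tendsto_intros qa)
  moreover have "\<forall>\<^sub>F s in at a. of_nat m + (s - a) * (poly (pderiv q) s / poly q s)
                    = (s - a) * (poly (pderiv p) s / poly p s)"
  proof -
    have "q \<noteq> 0" using qa by auto
    hence "\<forall>\<^sub>F s in at a. poly q s \<noteq> 0"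
      by (intro eventually_at_if_cofinite eventually_cofinite_poly_neq_0)
    moreover have "\<forall>\<^sub>F s in at a. s \<noteq> a"
      by (simp add: eventually_at_filter)
    ultimately show ?thesis
    proof eventually_elim
      case (elim s)
      show ?case
      proof (cases m)
        case 0
        then show ?thesis by (simp add: pq)
      next
        case (Suc k)
        \<comment> \<open>The common factor \<open>X\<close>, of exponent \<open>m - 1\<close>,
          cancels between \<open>pderiv p\<close> and \<open>p\<close>.\<close>
        define X where "X = (s - a) ^ k"
        have "X \<noteq> 0" using elim by (simp add: X_def)
        have 1: "poly (pderiv p) s = X * (of_nat m * poly q s + (s - a) * poly (pderiv q) s)"
          unfolding pq pderiv_mult pderiv_power Suc
          by (simp add: pderiv_pCons X_def algebra_simps)
        have 2: "poly p s = (s - a) * X * poly q s"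
          unfolding pq Suc X_def poly_mult poly_power by simp
        show ?thesis unfolding 1 2 using elim \<open>X \<noteq> 0\<close> by (simp add: field_simps)
      qed
    qed
  qed
  ultimately show ?thesis
    using Lim_transform_eventually m_def by fastforce
qed

subsection \<open>Reducing substitutions are polynomials\<close>

lemma same_ode_subst_poly_iff:
  "same_ode (ode_subst (poly N) (hypergeom_ode a b c)) (fuchsian_ode S \<kappa> k q') \<longleftrightarrow>
     (\<forall>\<^sub>F s in cofinite.
        c * (poly (pderiv N) s / poly N s) + (a + b - c + 1) * (poly (pderiv N) s / poly (N - 1) s)
          - poly (pderiv (pderiv N)) s / poly (pderiv N) s = (\<Sum>d\<in>S. \<kappa> d / (s - d)) \<and>
        a * b * (poly (pderiv N) s)\<^sup>2 / (poly N s * poly (N - 1) s)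
          = (k * s - q') / poly (root_poly S) s)"
  by (simp add: same_ode_def ode_subst_def hypergeom_ode_def fuchsian_ode_def deriv_poly
      algebra_simps)

text \<open>Let \<open>z\<close> be a zero of the denominator, of order \<open>e\<close>. The
  numerator \<open>W\<close> of \<open>R'\<close> is not divisible by \<open>(s - z)^e\<close>,
  because \<open>pderiv N * M\<close> is and \<open>N * pderiv M\<close> is not. The identity for
  the coefficients of \<open>u\<close>, however, requires this divisibility.\<close>

lemma reduces_imp_poly:
  assumes S: "finite S" and nontriv: "k \<noteq> 0 \<or> q' \<noteq> 0"
    and red: "reduces_to_hypergeom (fuchsian_ode S \<kappa> k q') R"
  obtains N where "R = poly N" "pderiv N \<noteq> 0"
proof -
  obtain N M a b c where NM: "M \<noteq> 0" "coprime N M" "R = (\<lambda>s. poly N s / poly M s)"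
    and ode: "same_ode (ode_subst R (hypergeom_ode a b c)) (fuchsian_ode S \<kappa> k q')"
    and nconst: "\<not> R constant_on UNIV"
    using red unfolding reduces_to_hypergeom_def rational_fun_def by blast
  define W where "W = pderiv N * M - N * pderiv M"
  define Q where "Q = [:-q', k:]"
  have Q: "Q \<noteq> 0" using nontriv by (auto simp: Q_def)
  have dR: "deriv R s = poly W s / (poly M s)\<^sup>2" if "poly M s \<noteq> 0" for s
    unfolding NM using that
    by (intro DERIV_imp_deriv) (auto intro!: derivative_eq_intros simp: W_def field_simps
        power2_eq_square)
  have N: "N \<noteq> 0"
    using nconst NM by (auto simp: constant_on_def)
  have N_M: "N - M \<noteq> 0"
  proof
    assume "N - M = 0"
    hence "N = M" by simp
    with NM(2) have "is_unit M" by simp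
    then obtain e where "M = [:e:]" "e \<noteq> 0" using NM(1) by (auto simp: is_unit_poly_iff)
    thus False using \<open>N = M\<close> nconst NM(3) by (auto simp: constant_on_def)
  qed
  \<comment> \<open>Insert \<open>R = N / M\<close>, \<open>R - 1 = (N - M) / M\<close> and
    \<open>R' = W / M^2\<close> into the coefficient of \<open>u\<close> and clear
    denominators.\<close>
  have id: "smult (a * b) (W\<^sup>2 * root_poly S) = Q * M\<^sup>2 * N * (N - M)"
  proof (rule poly_eqI_cofinite)
    have "\<forall>\<^sub>F s in cofinite. a * b / (R s * (R s - 1)) * (deriv R s)\<^sup>2
        = (k * s - q') / poly (root_poly S) s"
      using ode unfolding same_ode_def
      by (simp add: ode_subst_def hypergeom_ode_def fuchsian_ode_def eventually_conj_iff)
    with eventually_cofinite_poly_neq_0[OF NM(1)] eventually_cofinite_poly_neq_0[OF N]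
      eventually_cofinite_poly_neq_0[OF N_M] eventually_cofinite_poly_neq_0[OF root_poly_nz[of S]]
    show "\<forall>\<^sub>F s in cofinite. poly (smult (a * b) (W\<^sup>2 * root_poly S)) s
        = poly (Q * M\<^sup>2 * N * (N - M)) s"
    proof eventually_elim
      case (elim s)
      have "R s - 1 = poly (N - M) s / poly M s" using elim by (simp add: NM field_simps)
      hence "a * b / (R s * (R s - 1)) * (deriv R s)\<^sup>2
              = a * b * (poly W s)\<^sup>2 / ((poly M s)\<^sup>2 * poly N s * poly (N - M) s)"
        unfolding dR[OF elim(1)] using elim(1-3) by (simp add: NM(3) power2_eq_square mult_ac)
      with elim have "a * b * (poly W s)\<^sup>2 / ((poly M s)\<^sup>2 * poly N s * poly (N - M) s)
            = (k * s - q') / poly (root_poly S) s" by metis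
      hence "a * b * (poly W s)\<^sup>2 * poly (root_poly S) s
            = (k * s - q') * ((poly M s)\<^sup>2 * poly N s * poly (N - M) s)"
        using elim(1-4) by (subst (asm) frac_eq_eq) auto
      moreover have "poly Q s = k * s - q'" by (simp add: Q_def algebra_simps)
      ultimately show ?case
        unfolding poly_smult poly_mult poly_power by (simp only: mult_ac)
    qed
  qed
  \<comment> \<open>Nontriviality of the equation makes this side nonzero, hence also
    \<open>a * b\<close> and \<open>W\<close>.\<close>
  have rhs: "Q * M\<^sup>2 * N * (N - M) \<noteq> 0"
    using Q NM N N_M by simp
  have ab: "a * b \<noteq> 0" and W: "W \<noteq> 0"
    using rhs unfolding id[symmetric] by auto
  have "degree M = 0"
  proof (rule ccontr)
    assume "degree M \<noteq> 0"
    then obtain z where z: "poly M z = 0"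
      using fundamental_theorem_of_algebra[of M] by (auto simp: constant_degree)
    have Nz: "poly N z \<noteq> 0"
      using z coprime_poly_0[OF NM(2), of z] by simp
    have "poly (N - M) z \<noteq> 0" using z Nz by simp
    hence o0: "order z N = 0" "order z (N - M) = 0"
      by (simp_all add: Nz order_0I)
    have M': "pderiv M \<noteq> 0"
      using \<open>degree M \<noteq> 0\<close> by (simp add: pderiv_eq_0_iff)
    have oM: "order z M = Suc (order z (pderiv M))"
      by (rule order_pderiv[OF NM(1) z])
    have "order z (smult (a * b) (W\<^sup>2 * root_poly S)) = 2 * order z W + (if z \<in> S then 1 else 0)"
      using ab W S by (simp add: order_smult order_mult power2_eq_square order_root_poly)
    moreover have "order z (Q * M\<^sup>2 * N * (N - M)) = order z Q + 2 * order z M"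
      using Q NM N N_M by (simp add: order_mult power2_eq_square o0 del: right_diff_distrib)
    ultimately have "2 * order z W + (if z \<in> S then 1 else 0) = order z Q + 2 * order z M"
      unfolding id by simp
    \<comment> \<open>Parity: \<open>2 * order z W + 1 \<ge> 2 * order z M\<close> already excludes
      \<open>order z W < order z M\<close>.\<close>
    hence "order z M \<le> order z W"
      by (simp split: if_splits)
    hence "[:-z, 1:] ^ order z M dvd W"
      using W by (simp add: order_divides)
    moreover have "[:-z, 1:] ^ order z M dvd pderiv N * M"
      by (intro dvd_mult order_1)
    ultimately have "[:-z, 1:] ^ order z M dvd pderiv N * M - W"
      by (rule dvd_diff[rotated])
    hence "[:-z, 1:] ^ order z M dvd N * pderiv M" by (simp add: W_def)
    hence "order z M \<le> order z (N * pderiv M)"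
      using N M' by (simp add: order_divides)
    thus False using N M' by (simp add: order_mult o0 oM)
  qed
  then obtain e where e: "M = [:e:]" by (metis degree_eq_zeroE)
  hence "R = poly (smult (1 / e) N)" unfolding NM(3) by auto
  moreover have "pderiv (smult (1 / e) N) \<noteq> 0"
  proof -
    have "W = smult e (pderiv N)" unfolding W_def e by (simp add: pderiv_pCons)
    thus ?thesis using W by (auto simp: pderiv_smult)
  qed
  ultimately show ?thesis using that by blast
qed

subsection \<open>Ramification of the substitution\<close>

text \<open>\<open>root_poly S\<close> and the linear factor have only simple roots, so comparing
  orders at one point turns the identity into a count of multiplicities.\<close>

lemma local_orders:
  assumes S: "finite S" and K: "K \<noteq> 0" and N': "pderiv N \<noteq> 0"
    and id: "smult K ((pderiv N)\<^sup>2 * root_poly S) = [:-q, 1:] * N * (N - 1)"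
  shows "2 * order z (pderiv N) + of_bool (z \<in> S) = of_bool (z = q) + order z N + order z (N - 1)"
proof -
  have nz: "N \<noteq> 0" "N - 1 \<noteq> 0" using N' by (auto simp: pderiv_pCons)
  have "order z [:-q, 1:] = of_bool (z = q)"
    using order_power_n_n[of q 1] by (auto simp: order_0I)
  hence "order z ([:-q, 1:] * N * (N - 1)) = of_bool (z = q) + order z N + order z (N - 1)"
    using nz by (simp add: order_mult del: mult_pCons_left right_diff_distrib)
  moreover have "order z (smult K ((pderiv N)\<^sup>2 * root_poly S))
      = 2 * order z (pderiv N) + of_bool (z \<in> S)"
    using K N' S by (simp add: order_smult order_mult power2_eq_square order_root_poly)
  ultimately show ?thesis using id by metis
qed

text \<open>Multiplying the coefficient of \<open>u'\<close> by \<open>s - z\<close> and letting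
  \<open>s\<close> tend to \<open>z\<close> replaces each logarithmic derivative by a multiplicity;
  the second term is one too, since \<open>N - 1\<close> and \<open>N\<close> have the same
  derivative.\<close>

lemma local_residues:
  fixes N :: "complex poly"
  assumes S: "finite S" and N': "pderiv N \<noteq> 0"
    and lin: "\<forall>\<^sub>F s in cofinite.
        c * (poly (pderiv N) s / poly N s) + c' * (poly (pderiv N) s / poly (N - 1) s)
          - poly (pderiv (pderiv N)) s / poly (pderiv N) s = (\<Sum>d\<in>S. \<kappa> d / (s - d))"
  shows "c * of_nat (order z N) + c' * of_nat (order z (N - 1)) - of_nat (order z (pderiv N))
           = (if z \<in> S then \<kappa> z else 0)"
proof -
  have nz: "N \<noteq> 0" "N - 1 \<noteq> 0" using N' by (auto simp: pderiv_pCons)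
  have d1: "pderiv (N - 1) = pderiv N" by (simp add: pderiv_diff)
  let ?l = "\<lambda>s. c * ((s - z) * (poly (pderiv N) s / poly N s))
               + c' * ((s - z) * (poly (pderiv (N - 1)) s / poly (N - 1) s))
               - (s - z) * (poly (pderiv (pderiv N)) s / poly (pderiv N) s)"
  have lim1: "(?l \<longlongrightarrow> c * of_nat (order z N) + c' * of_nat (order z (N - 1))
      - of_nat (order z (pderiv N))) (at z)"
    by (intro tendsto_intros tendsto_log_deriv_poly nz N')
  have "((\<lambda>s. \<Sum>d\<in>S. (s - z) * (\<kappa> d / (s - d))) \<longlongrightarrow> (\<Sum>d\<in>S. if d = z then \<kappa> z else 0)) (at z)"
  proof (intro tendsto_sum)
    fix d assume "d \<in> S"
    show "((\<lambda>s. (s - z) * (\<kappa> d / (s - d))) \<longlongrightarrow> (if d = z then \<kappa> z else 0)) (at z)"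
    proof (cases "d = z")
      case True
      have "\<forall>\<^sub>F s in at z. (s - z) * (\<kappa> d / (s - d)) = \<kappa> z"
        unfolding True by (auto simp: eventually_at_filter)
      thus ?thesis unfolding True by (simp add: tendsto_eventually)
    next
      case False
      have "((\<lambda>s. (s - z) * (\<kappa> d / (s - d))) \<longlongrightarrow> (z - z) * (\<kappa> d / (z - d))) (at z)"
        using False by (intro tendsto_intros) auto
      thus ?thesis using False by simp
    qed
  qed
  hence "((\<lambda>s. \<Sum>d\<in>S. (s - z) * (\<kappa> d / (s - d))) \<longlongrightarrow> (if z \<in> S then \<kappa> z else 0)) (at z)"
    using S by simp
  moreover have "\<forall>\<^sub>F s in at z. (\<Sum>d\<in>S. (s - z) * (\<kappa> d / (s - d))) = ?l s"
    using eventually_at_if_cofinite[OF lin]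
  proof eventually_elim
    case (elim s)
    show ?case
      by (simp only: sum_distrib_left[symmetric] elim[symmetric] d1) (simp add: algebra_simps)
  qed
  ultimately have "(?l \<longlongrightarrow> (if z \<in> S then \<kappa> z else 0)) (at z)"
    using Lim_transform_eventually by fast
  from tendsto_unique[OF trivial_limit_at lim1 this] show ?thesis .
qed

lemma poly_eq_prod_root_powers:
  fixes p :: "complex poly"
  shows "p = smult (lead_coeff p) (\<Prod>z\<in>{z. poly p z = 0}. [:-z, 1:] ^ order z p)"
  using complex_poly_decompose[of p] by simp

lemma order_pderiv_root:
  fixes N :: "complex poly"
  assumes "pderiv N \<noteq> 0" "poly N z = y"
  shows "order z (N - [:y:]) = Suc (order z (pderiv N))"
proof -
  have d: "pderiv (N - [:y:]) = pderiv N" by (simp add: pderiv_diff pderiv_pCons)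
  have "N - [:y:] \<noteq> 0" using assms(1) d by (metis pderiv_0)
  from order_pderiv[OF this, of z] show ?thesis using assms(2) d by simp
qed

text \<open>\<open>S0\<close> and \<open>S1\<close> are the singular points other than
  \<open>q\<close> over 0 and 1, \<open>h\<close> collects the double points over 1, and
  \<open>m\<close> is the multiplicity at \<open>q\<close>. The numbers \<open>c\<close> and
  \<open>c'\<close> stand for the residues of the hypergeometric equation at 0 and 1. The last three
  conditions are residues: \<open>2 c - 1\<close> or \<open>3 c - 2 = 0\<close> at \<open>q\<close>,
  and \<open>2 c' - 1 = 0\<close> at a root of \<open>h\<close>.\<close>

definition reduction_data ::
  "complex set \<Rightarrow> (complex \<Rightarrow> complex) \<Rightarrow> complex \<Rightarrow> complex poly \<Rightarrow> bool" where
  "reduction_data S \<kappa> q N \<longleftrightarrow>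
     (\<exists>S0 S1 h C m c c'. m = (if q \<in> S then 2 else 3) \<and> S0 \<union> S1 = S - {q} \<and> S0 \<inter> S1 = {} \<and> C \<noteq> 0 \<and>
        N = smult C (root_poly S0 * [:-q, 1:] ^ m) \<and> N - 1 = smult C (root_poly S1 * h\<^sup>2) \<and>
        lead_coeff h = 1 \<and> degree h = card S0 \<and> card S0 + card S1 = m \<and>
        (\<forall>d\<in>S0. \<kappa> d = c) \<and> (\<forall>d\<in>S1. \<kappa> d = c') \<and>
        (q \<in> S \<longrightarrow> \<kappa> q = 2 * c - 1) \<and> (q \<notin> S \<longrightarrow> c = 2/3) \<and> (degree h = 0 \<or> c' = 1/2))"

text \<open>The counts fix all multiplicities over 0 and 1, hence the factorizations, and the
  residues give the conditions on \<open>\<kappa>\<close>. Since \<open>c\<close> and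
  \<open>c'\<close> are arbitrary here, the lemma also applies to \<open>1 - N\<close> with the two
  interchanged.\<close>

lemma reduction_dataI:
  assumes S: "finite S" and K: "K \<noteq> 0" and N': "pderiv N \<noteq> 0"
    and id: "smult K ((pderiv N)\<^sup>2 * root_poly S) = [:-q, 1:] * N * (N - 1)"
    and lin: "\<forall>\<^sub>F s in cofinite.
        c * (poly (pderiv N) s / poly N s) + c' * (poly (pderiv N) s / poly (N - 1) s)
          - poly (pderiv (pderiv N)) s / poly (pderiv N) s = (\<Sum>d\<in>S. \<kappa> d / (s - d))"
    and sing: "q \<in> S \<Longrightarrow> \<kappa> q \<noteq> 0" and Nq: "poly N q = 0" and card: "card S = 3"
  shows "reduction_data S \<kappa> q N"
proof -
  have nz: "N \<noteq> 0" "N - 1 \<noteq> 0" using N' by (auto simp: pderiv_pCons)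
  note ord = local_orders[OF S K N' id]
  note res = local_residues[OF S N' lin]
  have o0: "order z N = Suc (order z (pderiv N))" "order z (N - 1) = 0" if "poly N z = 0" for z
    using order_pderiv_root[OF N' that] that by (auto simp: order_0I)
  have o1: "order z (N - 1) = Suc (order z (pderiv N))" "order z N = 0" if "poly N z = 1" for z
    using order_pderiv_root[OF N' that] that by (auto simp: order_0I one_pCons)
  define m where "m = (if q \<in> S then 2 else 3 :: nat)"
  \<comment> \<open>With \<open>o\<close> for the order, the count at \<open>q\<close> reads
    \<open>2 (o - 1) + [q in S] = 1 + o\<close>.\<close>
  have oq: "order q N = m"
    using ord[of q] o0[OF Nq] by (auto simp: m_def split: if_splits)
  \<comment> \<open>The residue at \<open>q\<close> is \<open>m c - (m - 1)\<close>; it must be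
    \<open>\<kappa> q\<close> for \<open>m = 2\<close> and 0 for \<open>m = 3\<close>.\<close>
  have cq: "if q \<in> S then \<kappa> q = 2 * c - 1 else c = 2/3"
  proof -
    have "order q (pderiv N) = m - 1" using o0[OF Nq] oq by simp
    thus ?thesis using res[of q] o0[OF Nq] by (auto simp: m_def field_simps split: if_splits)
  qed
  define Z0 where "Z0 = {z. poly N z = 0}"
  define Z1 where "Z1 = {z. poly (N - 1) z = 0}"
  define S0 where "S0 = Z0 - {q}"
  define S1 where "S1 = Z1 \<inter> S"
  define G where "G = Z1 - S"
  have fin: "finite Z0" "finite Z1" using nz poly_roots_finite unfolding Z0_def Z1_def by blast+
  have Z1q: "q \<notin> Z1" using Nq by (simp add: Z1_def)
  have z0: "z \<in> S \<and> order z N = 1 \<and> \<kappa> z = c" if "z \<in> S0" for z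
  proof -
    have z: "poly N z = 0" "z \<noteq> q" using that by (auto simp: S0_def Z0_def)
    \<comment> \<open>Away from \<open>q\<close> the count is
      \<open>2 (o - 1) + [z in S] = o\<close>.\<close>
    have o: "order z N = 2 - of_bool (z \<in> S)" using ord[of z] o0[OF z(1)] z(2) by auto
    show ?thesis
    proof (cases "z \<in> S")
      case True
      then show ?thesis using o o0[OF z(1)] res[of z] by simp
    next
      case False
      \<comment> \<open>A nonsingular point over 0 would be double, with residue
        \<open>2 c - 1 = 0\<close>. But \<open>c = 1/2\<close> gives \<open>\<kappa> q = 0\<close>
        if \<open>q\<close> is singular and contradicts \<open>c = 2/3\<close> otherwise.\<close>
      have "c * 2 = 1" using o o0[OF z(1)] res[of z] False by simp
      hence "c = 1/2" by (simp add: field_simps)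
      with cq sing show ?thesis by (auto split: if_splits)
    qed
  qed
  have z1: "order z (N - 1) = (if z \<in> S then 1 else 2) \<and> (if z \<in> S then \<kappa> z = c' else c' = 1/2)"
    if "z \<in> Z1" for z
  proof -
    have z: "poly N z = 1" "z \<noteq> q" using that Z1q by (auto simp: Z1_def)
    have o: "order z (N - 1) = (if z \<in> S then 1 else 2)" using ord[of z] o1[OF z(1)] z(2) by auto
    show ?thesis using o o1[OF z(1)] res[of z] by (auto simp: field_simps split: if_splits)
  qed
  have S01: "S0 \<union> S1 = S - {q}"
  proof -
    \<comment> \<open>Over any other value the right side of the count is 0, while a point of
      \<open>S\<close> contributes 1 to the left.\<close>
    have "poly N d = 0 \<or> poly N d = 1" if "d \<in> S" "d \<noteq> q" for d
    proof (rule ccontr)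
      assume "\<not> ?thesis"
      hence "order d N = 0" "order d (N - 1) = 0" by (auto intro!: order_0I)
      with ord[of d] that show False by simp
    qed
    hence "S - {q} \<subseteq> S0 \<union> S1" by (auto simp: S0_def S1_def Z0_def Z1_def)
    moreover have "S0 \<subseteq> S - {q}" using z0 by (auto simp: S0_def)
    moreover have "S1 \<subseteq> S - {q}" using Z1q by (auto simp: S1_def)
    ultimately show ?thesis by blast
  qed
  have disj: "S0 \<inter> S1 = {}" by (auto simp: S0_def S1_def Z0_def Z1_def)
  have finS: "finite S0" "finite S1" "finite G" using fin by (auto simp: S0_def S1_def G_def)
  have cards: "card S0 + card S1 = m"
  proof -
    have "card S0 + card S1 = card (S - {q})"
      using card_Un_disjoint[OF finS(1,2) disj] S01 by simp
    thus ?thesis using card S by (simp add: m_def)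
  qed
  define C where "C = lead_coeff N"
  have degN: "degree N > 0" using N' by (simp add: pderiv_eq_0_iff)
  have lc: "lead_coeff (N - 1) = C"
    using degN lead_coeff_add_le[of "-1" N] unfolding C_def by simp
  define h where "h = root_poly G"
  have fN: "N = smult C (root_poly S0 * [:-q, 1:] ^ m)"
  proof -
    have "Z0 = insert q S0" using Nq by (auto simp: S0_def Z0_def)
    moreover have q0: "q \<notin> S0" by (simp add: S0_def)
    ultimately have "(\<Prod>z\<in>Z0. [:-z, 1:] ^ order z N)
        = [:-q, 1:] ^ m * (\<Prod>z\<in>S0. [:-z, 1:] ^ order z N)"
      using finS(1) oq by simp
    also have "(\<Prod>z\<in>S0. [:-z, 1:] ^ order z N) = root_poly S0"
      unfolding root_poly_def using z0 by (intro prod.cong) auto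
    finally show ?thesis
      using poly_eq_prod_root_powers[of N] by (simp add: Z0_def C_def mult.commute)
  qed
  have fN1: "N - 1 = smult C (root_poly S1 * h\<^sup>2)"
  proof -
    have "Z1 = S1 \<union> G" "S1 \<inter> G = {}" by (auto simp: S1_def G_def)
    hence "(\<Prod>z\<in>Z1. [:-z, 1:] ^ order z (N - 1))
        = (\<Prod>z\<in>S1. [:-z, 1:] ^ order z (N - 1)) * (\<Prod>z\<in>G. [:-z, 1:] ^ order z (N - 1))"
      using finS by (simp add: prod.union_disjoint)
    also have "(\<Prod>z\<in>S1. [:-z, 1:] ^ order z (N - 1)) = root_poly S1"
      unfolding root_poly_def using z1 by (intro prod.cong) (auto simp: S1_def)
    also have "(\<Prod>z\<in>G. [:-z, 1:] ^ order z (N - 1)) = h\<^sup>2"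
      unfolding h_def root_poly_def prod_power_distrib using z1
      by (intro prod.cong) (auto simp: G_def)
    finally show ?thesis
      using poly_eq_prod_root_powers[of "N - 1"] lc by (simp add: Z1_def)
  qed
  have C: "C \<noteq> 0" using nz by (simp add: C_def)
  \<comment> \<open>The degrees of \<open>N\<close> and \<open>N - 1\<close> give
    \<open>card S0 + m = card S1 + 2 * degree h\<close>, where
    \<open>m = card S0 + card S1\<close>.\<close>
  have degh: "degree h = card S0"
  proof -
    have "degree N = card S0 + m"
      using C finS by (subst fN) (simp add: degree_mult_eq degree_root_poly degree_power_eq)
    moreover have "degree (N - 1) = card S1 + 2 * degree h"
      using C finS
      by (subst fN1) (simp add: degree_mult_eq degree_root_poly degree_power_eq h_def)
    moreover have "degree (N - 1) = degree N"
      using degN degree_add_eq_left[of "-1" N] by simp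
    ultimately show ?thesis using cards by simp
  qed
  have hc: "degree h = 0 \<or> c' = 1/2"
  proof (cases "G = {}")
    case True
    then show ?thesis by (simp add: h_def root_poly_def)
  next
    case False
    then obtain z where "z \<in> G" by blast
    then show ?thesis using z1[of z] by (simp add: G_def)
  qed
  have "\<forall>d\<in>S0. \<kappa> d = c" using z0 by blast
  moreover have "\<forall>d\<in>S1. \<kappa> d = c'"
  proof
    fix d assume "d \<in> S1"
    thus "\<kappa> d = c'" using z1[of d] by (simp add: S1_def)
  qed
  moreover have "lead_coeff h = 1" by (simp add: h_def lead_coeff_root_poly)
  moreover have "q \<in> S \<longrightarrow> \<kappa> q = 2 * c - 1" "q \<notin> S \<longrightarrow> c = 2/3"
    using cq by (simp_all split: if_splits)
  ultimately show ?thesis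
    unfolding reduction_data_def
    by - (rule exI[of _ S0], rule exI[of _ S1], rule exI[of _ h], rule exI[of _ C],
        rule exI[of _ m],
        rule exI[of _ c], rule exI[of _ c'], intro conjI,
        (rule m_def S01 disj C fN fN1 degh cards hc | assumption)+)
qed

text \<open>The numerator \<open>k * s - k * d\<close> cancels the factor \<open>s - d\<close>, and
  the pole of the other coefficient has residue \<open>\<kappa> d = 0\<close>. Contrapositively, if
  \<open>q\<close> is singular then \<open>\<kappa> q\<close> is nonzero.\<close>

lemma ordinary_point_fuchsian:
  assumes S: "finite S" and d: "d \<in> S" "\<kappa> d = 0"
  shows "ordinary_point (fuchsian_ode S \<kappa> k (k * d)) d"
  unfolding ordinary_point_def
proof (intro exI conjI)
  let ?p = "\<lambda>s. \<Sum>e\<in>S - {d}. \<kappa> e / (s - e)" and ?q = "\<lambda>s. k / poly (root_poly (S - {d})) s"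
  show "?p analytic_on {d}"
    by (intro analytic_intros) auto
  show "?q analytic_on {d}"
    unfolding poly_root_poly by (intro analytic_intros) (use S in auto)
  have "fst (fuchsian_ode S \<kappa> k (k * d)) s = ?p s \<and> snd (fuchsian_ode S \<kappa> k (k * d)) s = ?q s"
    if "s \<noteq> d" for s
  proof
    show "fst (fuchsian_ode S \<kappa> k (k * d)) s = ?p s"
      using S d by (simp add: fuchsian_ode_def sum.remove)
    have "(\<Prod>e\<in>S. s - e) = (s - d) * (\<Prod>e\<in>S - {d}. s - e)"
      using S d by (simp add: prod.remove)
    thus "snd (fuchsian_ode S \<kappa> k (k * d)) s = ?q s"
      using that by (simp add: fuchsian_ode_def poly_root_poly flip: right_diff_distrib)
  qed
  thus "\<forall>\<^sub>F s in at d. fst (fuchsian_ode S \<kappa> k (k * d)) s = ?p s \<and>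
          snd (fuchsian_ode S \<kappa> k (k * d)) s = ?q s"
    by (auto simp: eventually_at_filter)
qed

text \<open>The zero \<open>q' / k\<close> of the numerator lies over 0 or over 1; \<open>N\<close>
  is \<open>R\<close> in the first case and \<open>1 - R\<close> in the second.\<close>

lemma reduces_imp_reduction_data:
  assumes S: "finite S" "card S = 3" and nontriv: "k \<noteq> 0 \<or> q' \<noteq> 0"
    and sing: "\<And>d. d \<in> S \<Longrightarrow> \<not> ordinary_point (fuchsian_ode S \<kappa> k q') d"
    and red: "reduces_to_hypergeom (fuchsian_ode S \<kappa> k q') R"
  shows "\<exists>p. R = poly p" "k \<noteq> 0"
    "\<exists>N. reduction_data S \<kappa> (q' / k) N \<and> (R = poly N \<or> R = (\<lambda>s. 1 - poly N s))"
proof -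
  obtain N where R: "R = poly N" and N': "pderiv N \<noteq> 0"
    using reduces_imp_poly[OF S(1) nontriv red] .
  have nz: "N \<noteq> 0" "N - 1 \<noteq> 0" using N' by (auto simp: pderiv_pCons)
  obtain a b c where ode: "\<forall>\<^sub>F s in cofinite.
        c * (poly (pderiv N) s / poly N s) + (a + b - c + 1) * (poly (pderiv N) s / poly (N - 1) s)
          - poly (pderiv (pderiv N)) s / poly (pderiv N) s = (\<Sum>d\<in>S. \<kappa> d / (s - d)) \<and>
        a * b * (poly (pderiv N) s)\<^sup>2 / (poly N s * poly (N - 1) s)
          = (k * s - q') / poly (root_poly S) s"
    using red unfolding reduces_to_hypergeom_def R same_ode_subst_poly_iff by blast
  define c' where "c' = a + b - c + 1"
  note lin = eventually_conj_iff[THEN iffD1, OF ode, THEN conjunct1, folded c'_def]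
  have id0: "smult (a * b) ((pderiv N)\<^sup>2 * root_poly S) = [:-q', k:] * N * (N - 1)"
  proof (rule poly_eqI_cofinite)
    show "\<forall>\<^sub>F s in cofinite. poly (smult (a * b) ((pderiv N)\<^sup>2 * root_poly S)) s
            = poly ([:-q', k:] * N * (N - 1)) s"
      using eventually_conj_iff[THEN iffD1, OF ode, THEN conjunct2]
        eventually_cofinite_poly_neq_0[OF nz(1)] eventually_cofinite_poly_neq_0[OF nz(2)]
        eventually_cofinite_poly_neq_0[OF root_poly_nz[of S]]
    proof eventually_elim
      case (elim s)
      hence "a * b * (poly (pderiv N) s)\<^sup>2 * poly (root_poly S) s
               = (k * s - q') * (poly N s * poly (N - 1) s)"
        by (subst (asm) frac_eq_eq) auto
      moreover have "poly [:-q', k:] s = k * s - q'" by (simp add: algebra_simps)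
      ultimately show ?case
        unfolding poly_smult poly_mult poly_power by (simp only: mult_ac)
    qed
  qed
  have Q: "[:-q', k:] \<noteq> 0" using nontriv by auto
  have rhs: "[:-q', k:] * N * (N - 1) \<noteq> 0" using Q nz by (simp only: mult_eq_0_iff) simp
  hence ab: "a * b \<noteq> 0" unfolding id0[symmetric] by auto
  have degN: "degree N > 0" using N' by (simp add: pderiv_eq_0_iff)
  have degN1: "degree (N - 1) = degree N"
    using degN degree_add_eq_left[of "-1" N] by simp
  have "degree ([:-q', k:] * N * (N - 1)) = degree [:-q', k:] + 2 * degree N"
    using Q nz degN1 by (simp add: degree_mult_eq del: mult_pCons_left right_diff_distrib)
  moreover have "degree (smult (a * b) ((pderiv N)\<^sup>2 * root_poly S)) = 2 * (degree N - 1) + 3"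
    using ab N' S by (simp add: degree_mult_eq degree_power_eq degree_root_poly degree_pderiv)
  \<comment> \<open>With \<open>n = degree N\<close> the degrees give
    \<open>2 (n - 1) + 3 = degree [:-q', k:] + 2 n\<close>, so the numerator is genuinely
    linear.\<close>
  ultimately have "degree [:-q', k:] = 1"
    using degN unfolding id0 by linarith
  thus k: "k \<noteq> 0" by auto
  define q where "q = q' / k"
  have q': "q' = k * q" using k by (simp add: q_def)
  define K where "K = a * b / k"
  have K: "K \<noteq> 0" using ab k by (simp add: K_def)
  have id: "smult K ((pderiv N)\<^sup>2 * root_poly S) = [:-q, 1:] * N * (N - 1)"
  proof -
    have "smult k (smult K ((pderiv N)\<^sup>2 * root_poly S)) = [:-q', k:] * N * (N - 1)"
      using k id0 by (simp add: K_def)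
    also have "[:-q', k:] = smult k [:-q, 1:]" by (simp add: q')
    also have "\<dots> * N * (N - 1) = smult k ([:-q, 1:] * N * (N - 1))"
      by (simp only: mult_smult_left)
    finally show ?thesis using k by (metis smult_cancel)
  qed
  have sq: "\<kappa> q \<noteq> 0" if "q \<in> S"
    using ordinary_point_fuchsian[OF S(1) that, of \<kappa> k] sing[OF that] q' by auto
  \<comment> \<open>Otherwise the count at \<open>q\<close> forces \<open>q\<close> into
    \<open>S\<close> and \<open>N'\<close> to be nonzero there; the residue is then 0, against
    \<open>\<kappa> q \<noteq> 0\<close>.\<close>
  have "poly N q = 0 \<or> poly N q = 1"
  proof (rule ccontr)
    assume "\<not> ?thesis"
    hence o: "order q N = 0" "order q (N - 1) = 0" by (auto intro!: order_0I)
    have ord: "2 * order q (pderiv N) + of_bool (q \<in> S) = (1 :: nat)"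
      using local_orders[OF S(1) K N' id, of q] o by simp
    hence "q \<in> S" "order q (pderiv N) = 0" by (cases "q \<in> S"; simp; presburger)+
    with local_residues[OF S(1) N' lin, of q] o sq show False by simp
  qed
  thus "\<exists>N. reduction_data S \<kappa> (q' / k) N \<and> (R = poly N \<or> R = (\<lambda>s. 1 - poly N s))"
  proof
    assume Nq: "poly N q = 0"
    have "reduction_data S \<kappa> q N"
      by (rule reduction_dataI[OF S(1) K N' id lin _ Nq S(2)]) (rule sq)
    thus ?thesis unfolding R q_def by blast
  next
    assume Nq: "poly N q = 1"
    \<comment> \<open>Passing to \<open>1 - N\<close> exchanges 0 with 1, hence \<open>c\<close>
      with \<open>c'\<close>.\<close>
    define M where "M = 1 - N"
    have dM: "pderiv M = - pderiv N" and NM: "N = 1 - M" "N - 1 = - M"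
      by (simp_all add: M_def pderiv_diff)
    have M': "pderiv M \<noteq> 0" using N' by (simp add: dM)
    have idM: "smult K ((pderiv M)\<^sup>2 * root_poly S) = [:-q, 1:] * M * (M - 1)"
    proof -
      have "[:-q, 1:] * N * (N - 1) = [:-q, 1:] * M * (M - 1)"
        unfolding NM by (simp only: mult.assoc) (simp add: algebra_simps)
      thus ?thesis using id by (simp add: dM)
    qed
    have linM: "\<forall>\<^sub>F s in cofinite.
        c' * (poly (pderiv M) s / poly M s) + c * (poly (pderiv M) s / poly (M - 1) s)
          - poly (pderiv (pderiv M)) s / poly (pderiv M) s = (\<Sum>d\<in>S. \<kappa> d / (s - d))"
      using lin
    proof eventually_elim
      case (elim s)
      have e: "poly M s = - poly (N - 1) s" "poly (M - 1) s = - poly N s" by (simp_all add: M_def)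
      show ?case unfolding elim[symmetric] dM pderiv_minus e poly_minus
        by (simp add: algebra_simps del: poly_diff)
    qed
    have Mq: "poly M q = 0" using Nq by (simp add: M_def)
    have "reduction_data S \<kappa> q M"
      by (rule reduction_dataI[OF S(1) K M' idM linM _ Mq S(2)]) (rule sq)
    moreover have "R = (\<lambda>s. 1 - poly M s)" unfolding R by (rule ext) (simp add: M_def)
    ultimately show ?thesis unfolding q_def by blast
  qed
qed (use assms reduces_imp_poly in blast)

subsection \<open>Sufficiency of the ramification data\<close>

text \<open>Unlike in \<^const>\<open>reduction_data\<close>, \<open>h\<close> need not be monic, which makes this form stable under
  affine substitutions.\<close>

definition belyi_form ::
  "complex set \<Rightarrow> complex set \<Rightarrow> complex \<Rightarrow> nat \<Rightarrow> complex poly \<Rightarrow> complex poly \<Rightarrow> bool" where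
  "belyi_form S0 S1 q m h N \<longleftrightarrow>
     (\<exists>C C' K. C \<noteq> 0 \<and> C' \<noteq> 0 \<and> K \<noteq> 0 \<and> h \<noteq> 0 \<and>
        N = smult C (root_poly S0 * [:-q, 1:] ^ m) \<and> N - 1 = smult C' (root_poly S1 * h\<^sup>2) \<and>
        pderiv N = smult K ([:-q, 1:] ^ (m - 1) * h))"

definition log_deriv :: "complex poly \<Rightarrow> complex \<Rightarrow> complex" where
  "log_deriv p s = poly (pderiv p) s / poly p s"

lemma log_deriv_mult:
  "poly p s \<noteq> 0 \<Longrightarrow> poly q s \<noteq> 0 \<Longrightarrow> log_deriv (p * q) s = log_deriv p s + log_deriv q s"
  by (simp add: log_deriv_def pderiv_mult field_simps)

lemma log_deriv_smult: "c \<noteq> 0 \<Longrightarrow> log_deriv (smult c p) s = log_deriv p s"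
  by (simp add: log_deriv_def pderiv_smult)

lemma log_deriv_power: "poly p s \<noteq> 0 \<Longrightarrow> log_deriv (p ^ n) s = of_nat n * log_deriv p s"
proof (induction n)
  case (Suc n)
  have "log_deriv (p * p ^ n) s = log_deriv p s + log_deriv (p ^ n) s"
    using Suc.prems by (intro log_deriv_mult) auto
  then show ?case using Suc by (simp add: algebra_simps)
qed (simp add: log_deriv_def)

lemma log_deriv_linear: "log_deriv [:-d, 1:] s = 1 / (s - d)"
  by (simp add: log_deriv_def pderiv_pCons)

lemma log_deriv_root_poly:
  "finite S \<Longrightarrow> s \<notin> S \<Longrightarrow> log_deriv (root_poly S) s = (\<Sum>d\<in>S. 1 / (s - d))"
proof (induction S rule: finite_induct)
  case (insert d S)
  have eq: "root_poly (insert d S) = [:-d, 1:] * root_poly S"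
    using insert by (simp add: root_poly_def)
  show ?case unfolding eq
    using insert by (subst log_deriv_mult)
      (auto simp: poly_root_poly_eq_0_iff log_deriv_linear)
qed (simp add: log_deriv_def root_poly_def)

text \<open>The hypergeometric equation contains \<open>a\<close> and \<open>b\<close> only through
  their sum and product, so these two numbers can be prescribed instead.\<close>

lemma sum_and_product_exist: "\<exists>a b :: complex. a + b = x \<and> a * b = y"
proof -
  define r where "r = csqrt (x\<^sup>2 - 4 * y)"
  have "r\<^sup>2 = x\<^sup>2 - 4 * y" by (simp add: r_def)
  hence "(x + r) / 2 * ((x - r) / 2) = y" by (simp add: field_simps power2_eq_square)
  moreover have "(x + r) / 2 + (x - r) / 2 = x" by (simp add: field_simps)
  ultimately show ?thesis by blast
qed

text \<open>Expand the three logarithmic derivatives in partial fractions: the residues are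
  \<open>c\<close> on \<open>S0\<close>, \<open>c'\<close> on \<open>S1\<close> and
  \<open>m c - (m - 1)\<close> at \<open>q\<close>, and the terms from \<open>h\<close> cancel
  because \<open>c' = 1/2\<close> or \<open>h\<close> is constant.\<close>

lemma belyi_form_reduces:
  assumes form: "belyi_form S0 S1 q m h N"
    and fin: "finite S0" "finite S1" and disj: "S0 \<inter> S1 = {}" and q: "q \<notin> S0 \<union> S1"
    and S: "m = 2 \<and> S = insert q (S0 \<union> S1) \<and> \<kappa> q = 2 * c - 1 \<or> m = 3 \<and> S = S0 \<union> S1 \<and> c = 2/3"
    and c: "\<And>d. d \<in> S0 \<Longrightarrow> \<kappa> d = c" and c': "\<And>d. d \<in> S1 \<Longrightarrow> \<kappa> d = c'"
    and hc: "degree h = 0 \<or> c' = 1/2"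
  shows "reduces_to_hypergeom (fuchsian_ode S \<kappa> k (k * q)) (poly N)"
    "reduces_to_hypergeom (fuchsian_ode S \<kappa> k (k * q)) (\<lambda>s. 1 - poly N s)"
proof -
  obtain C C' K where CK: "C \<noteq> 0" "C' \<noteq> 0" "K \<noteq> 0" "h \<noteq> 0"
    and N: "N = smult C (root_poly S0 * [:-q, 1:] ^ m)"
    and N1: "N - 1 = smult C' (root_poly S1 * h\<^sup>2)"
    and N': "pderiv N = smult K ([:-q, 1:] ^ (m - 1) * h)"
    using form unfolding belyi_form_def by blast
  have dN: "pderiv N \<noteq> 0" unfolding N' using CK by simp
  have finS: "finite S" using S fin by auto
  \<comment> \<open>The value intended for \<open>a * b\<close>: it offsets the constant
    \<open>K^2 / (C C')\<close> of \<open>(N')^2 / (N (N - 1))\<close> and leaves the factor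
    \<open>k\<close>.\<close>
  define X where "X = k * C * C' / K\<^sup>2"
  have eqs: "\<forall>\<^sub>F s in cofinite. s \<notin> S \<and>
      c * (poly (pderiv N) s / poly N s) + c' * (poly (pderiv N) s / poly (N - 1) s)
          - poly (pderiv (pderiv N)) s / poly (pderiv N) s = (\<Sum>d\<in>S. \<kappa> d / (s - d)) \<and>
      X * (poly (pderiv N) s)\<^sup>2 / (poly N s * poly (N - 1) s)
          = (k * s - k * q) / poly (root_poly S) s"
  proof -
    have "\<forall>\<^sub>F s in cofinite. poly (root_poly (insert q S)) s \<noteq> 0 \<and> poly h s \<noteq> 0"
      using CK by (intro eventually_conj eventually_cofinite_poly_neq_0) auto
    thus ?thesis
    proof eventually_elim
      case (elim s)
      have s: "s \<noteq> q" "s \<notin> S" "s \<notin> S0" "s \<notin> S1" and hs: "poly h s \<noteq> 0"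
        using elim finS S by (auto simp: poly_root_poly_eq_0_iff)
      have r: "poly (root_poly S0) s \<noteq> 0" "poly (root_poly S1) s \<noteq> 0"
        using s fin by (simp_all add: poly_root_poly_eq_0_iff)
      have l: "poly [:-q, 1:] s \<noteq> 0" using s by simp
      define A where "A = (\<Sum>d\<in>S0. 1 / (s - d))"
      define A' where "A' = (\<Sum>d\<in>S1. 1 / (s - d))"
      define u where "u = s - q"
      define H where "H = log_deriv h s"
      have u: "u \<noteq> 0" using s by (simp add: u_def)
      have lN: "log_deriv N s = A + of_nat m / u"
        unfolding N A_def using CK r l s fin
        by (simp add: log_deriv_smult log_deriv_mult log_deriv_power log_deriv_root_poly
            log_deriv_linear u_def)
      have lN1: "log_deriv (N - 1) s = A' + 2 * H"
        unfolding N1 A'_def using CK r hs s fin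
        by (simp add: log_deriv_smult log_deriv_mult log_deriv_power log_deriv_root_poly H_def)
      have lN': "log_deriv (pderiv N) s = of_nat (m - 1) / u + H"
        unfolding N' using CK l hs s
        by (simp add: log_deriv_smult log_deriv_mult log_deriv_power log_deriv_linear u_def H_def)
      \<comment> \<open>The logarithmic derivative of \<open>h\<close> enters with factor
        \<open>2 c'\<close> through \<open>N - 1\<close> and with factor \<open>-1\<close> through
        \<open>N'\<close>.\<close>
      have H: "2 * c' * H = H"
        using hc
      proof
        assume "degree h = 0"
        then obtain e where "h = [:e:]" by (metis degree_eq_zeroE)
        thus ?thesis by (simp add: H_def log_deriv_def pderiv_pCons)
      next
        assume c': "c' = 1/2"
        show ?thesis unfolding c' by simp
      qed
      have "(\<Sum>d\<in>S. \<kappa> d / (s - d)) = c * A + c' * A' + (c * of_nat m - of_nat (m - 1)) / u"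
      proof -
        have "(\<Sum>d\<in>S0 \<union> S1. \<kappa> d / (s - d)) = (\<Sum>d\<in>S0. \<kappa> d / (s - d)) + (\<Sum>d\<in>S1. \<kappa> d / (s - d))"
          using fin disj by (rule sum.union_disjoint)
        also have "\<dots> = c * A + c' * A'"
          unfolding A_def A'_def sum_distrib_left using c c' by simp
        finally show ?thesis
          using S q fin by (auto simp: u_def algebra_simps)
      qed
      hence lin: "c * log_deriv N s + c' * log_deriv (N - 1) s - log_deriv (pderiv N) s
               = (\<Sum>d\<in>S. \<kappa> d / (s - d))"
        unfolding lN lN1 lN' using H
        by (simp add: algebra_simps add_divide_distrib diff_divide_distrib)
      have rS: "poly (root_poly S) s = poly (root_poly S0) s * poly (root_poly S1) s *
          (if m = 2 then u else 1)"
        using S q root_poly_Un[OF fin disj] fin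
            by (auto simp: poly_root_poly u_def prod.union_disjoint disj)
      have p: "poly N s = C * (poly (root_poly S0) s * u ^ m)"
        "poly (N - 1) s = C' * (poly (root_poly S1) s * (poly h s)\<^sup>2)"
        "poly (pderiv N) s = K * (u ^ (m - 1) * poly h s)"
        using arg_cong[OF N, of "\<lambda>p. poly p s"] arg_cong[OF N1, of "\<lambda>p. poly p s"]
          arg_cong[OF N', of "\<lambda>p. poly p s"] by (simp_all add: u_def del: poly_diff)
      have "X * (poly (pderiv N) s)\<^sup>2 / (poly N s * poly (N - 1) s) = k * u / poly (root_poly S) s"
        unfolding p rS X_def using S CK r u hs
        by (auto simp: field_simps power2_eq_square power3_eq_cube)
      thus ?case using lin s by (simp add: log_deriv_def pderiv_diff u_def right_diff_distrib
          del: poly_diff)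
    qed
  qed
  \<comment> \<open>This sum makes \<open>a + b - c + 1\<close> equal to \<open>c'\<close>. It is
    symmetric in \<open>c\<close> and \<open>c'\<close>, so the same pair serves
    \<open>1 - N\<close> with \<open>c'\<close> as third parameter.\<close>
  obtain a b where ab: "a + b = c + c' - 1" "a * b = X" using sum_and_product_exist by blast
  have sum: "a + b - c + 1 = c'" "a + b - c' + 1 = c" using ab(1) by (simp_all add: algebra_simps)
  have "same_ode (ode_subst (poly N) (hypergeom_ode a b c)) (fuchsian_ode S \<kappa> k (k * q))"
    unfolding same_ode_subst_poly_iff sum ab(2) using eqs by eventually_elim blast
  moreover have rat: "rational_fun (poly M)" for M
    unfolding rational_fun_def by (rule exI[of _ M], rule exI[of _ 1]) auto
  moreover have nconst: "\<not> poly M constant_on UNIV" if "pderiv M \<noteq> 0" for M :: "complex poly"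
  proof
    assume "poly M constant_on UNIV"
    then obtain y where "\<And>s. poly M s = y" by (auto simp: constant_on_def)
    hence "poly M = poly [:y:]" by (intro ext) simp
    hence "M = [:y:]" by (simp only: poly_eq_poly_eq_iff)
    thus False using that by (simp add: pderiv_pCons)
  qed
  ultimately show "reduces_to_hypergeom (fuchsian_ode S \<kappa> k (k * q)) (poly N)"
    unfolding reduces_to_hypergeom_def using dN by blast
  define M where "M = 1 - N"
  have dM: "pderiv M = - pderiv N" by (simp add: M_def pderiv_diff)
  have "same_ode (ode_subst (poly M) (hypergeom_ode a b c')) (fuchsian_ode S \<kappa> k (k * q))"
    unfolding same_ode_subst_poly_iff sum ab(2) using eqs
  proof eventually_elim
    case (elim s)
    have e: "poly M s = - poly (N - 1) s" "poly (M - 1) s = - poly N s" by (simp_all add: M_def)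
    show ?case using elim unfolding dM pderiv_minus e poly_minus
      by (simp add: algebra_simps del: poly_diff)
  qed
  hence "reduces_to_hypergeom (fuchsian_ode S \<kappa> k (k * q)) (poly M)"
    unfolding reduces_to_hypergeom_def using dN rat nconst[of M] dM by auto
  moreover have "poly M = (\<lambda>s. 1 - poly N s)" by (rule ext) (simp add: M_def)
  ultimately show "reduces_to_hypergeom (fuchsian_ode S \<kappa> k (k * q)) (\<lambda>s. 1 - poly N s)"
    by simp
qed

section \<open>Affine changes of variable and the recognition of Belyi forms\<close>

lemma pcompose_root_poly:
  assumes "\<mu> \<noteq> 0"
  shows "pcompose (root_poly S) [:\<nu>, \<mu>:] = smult (\<mu> ^ card S) (root_poly ((\<lambda>d. (d - \<nu>) / \<mu>) ` S))"
proof -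
  have inj: "inj_on (\<lambda>d. (d - \<nu>) / \<mu>) S" using assms by (auto simp: inj_on_def)
  have "pcompose (root_poly S) [:\<nu>, \<mu>:] = (\<Prod>d\<in>S. smult \<mu> [:-((d - \<nu>) / \<mu>), 1:])"
    unfolding root_poly_def pcompose_prod using assms
    by (intro prod.cong) (auto simp: pcompose_pCons field_simps)
  also have "\<dots> = smult (\<mu> ^ card S) (\<Prod>d\<in>S. [:-((d - \<nu>) / \<mu>), 1:])"
    by (simp only: prod_smult prod_constant)
  finally show ?thesis unfolding root_poly_def by (simp add: prod.reindex[OF inj])
qed

lemma pcompose_power: "pcompose (p ^ n) r = pcompose p r ^ n"
  for p r :: "'a :: comm_semiring_1 poly"
  by (induction n) (simp_all add: pcompose_mult pcompose_1)

text \<open>An affine substitution moves the roots, and the powers of \<open>\<mu>\<close> are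
  absorbed by the constants. Hence each subcase has to be checked only at the points
  \<open>0\<close>, \<open>1\<close>, \<open>D\<close>.\<close>

lemma belyi_form_pcompose:
  fixes \<mu> \<nu> :: complex
  assumes form: "belyi_form S0 S1 q m h N" and \<mu>: "\<mu> \<noteq> 0"
  defines "T \<equiv> \<lambda>d. (d - \<nu>) / \<mu>"
  shows "belyi_form (T ` S0) (T ` S1) (T q) m (pcompose h [:\<nu>, \<mu>:]) (pcompose N [:\<nu>, \<mu>:])"
proof -
  let ?L = "[:\<nu>, \<mu>:]"
  obtain C C' K where CK: "C \<noteq> 0" "C' \<noteq> 0" "K \<noteq> 0" "h \<noteq> 0"
    and N: "N = smult C (root_poly S0 * [:-q, 1:] ^ m)"
    and N1: "N - 1 = smult C' (root_poly S1 * h\<^sup>2)"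
    and N': "pderiv N = smult K ([:-q, 1:] ^ (m - 1) * h)"
    using form unfolding belyi_form_def by blast
  have lin: "pcompose [:-q, 1:] ?L = smult \<mu> [:-T q, 1:]"
    using \<mu> by (simp add: pcompose_pCons T_def field_simps)
  have h: "pcompose h ?L \<noteq> 0" using CK \<mu> by (simp add: pcompose_eq_0_iff)
  define L where "L = [:-T q, 1:]"
  have linp: "pcompose ([:-q, 1:] ^ n) ?L = smult (\<mu> ^ n) (L ^ n)" for n
    unfolding pcompose_power lin smult_power L_def ..
  have "pcompose N ?L = smult (C * (\<mu> ^ card S0 * \<mu> ^ m)) (root_poly (T ` S0) * L ^ m)"
    unfolding N pcompose_smult pcompose_mult pcompose_root_poly[OF \<mu>] linp T_def
    by (simp add: mult_ac)
  moreover have "pcompose N ?L - 1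
      = smult (C' * \<mu> ^ card S1) (root_poly (T ` S1) * (pcompose h ?L)\<^sup>2)"
  proof -
    have "pcompose N ?L - 1 = pcompose (N - 1) ?L" by (simp add: pcompose_diff pcompose_1)
    thus ?thesis
      unfolding N1 pcompose_smult pcompose_mult pcompose_root_poly[OF \<mu>] pcompose_power T_def
          by simp
  qed
  moreover have "pderiv (pcompose N ?L) = smult (K * \<mu> ^ (m - 1) * \<mu>) (L ^ (m - 1) * pcompose h ?L)"
  proof -
    have "pderiv ?L = [:\<mu>:]" by (simp add: pderiv_pCons)
    thus ?thesis
      unfolding pderiv_pcompose N' pcompose_smult pcompose_mult linp
      by (simp add: mult_ac)
  qed
  ultimately show ?thesis unfolding belyi_form_def L_def
    using CK \<mu> h by (metis mult_eq_0_iff power_eq_0_iff)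
qed


text \<open>The two factorizations make \<open>(s - q)^(m - 1)\<close> and \<open>h\<close> divide
  the derivative. They are coprime, and their product already has the degree
  \<open>card S0 + m - 1\<close> of the derivative, so the cofactor is a constant.\<close>

lemma belyi_formI:
  assumes fin: "finite S0" "finite S1" and C: "C \<noteq> 0" "C' \<noteq> 0" and m: "m > 0"
    and h: "h \<noteq> 0" "degree h = card S0"
    and id: "\<And>t. C * ((\<Prod>d\<in>S0. t - d) * (t - q) ^ m) - 1 = C' * ((\<Prod>d\<in>S1. t - d) * (poly h t)\<^sup>2)"
  shows "belyi_form S0 S1 q m h (smult C (root_poly S0 * [:-q, 1:] ^ m))"
proof -
  define N where "N = smult C (root_poly S0 * [:-q, 1:] ^ m)"
  have N1: "N - 1 = smult C' (root_poly S1 * h\<^sup>2)"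
  proof -
    have "poly (N - 1) t = poly (smult C' (root_poly S1 * h\<^sup>2)) t" for t
      using id[of t] by (simp add: N_def poly_root_poly)
    thus ?thesis by (rule poly_eqI_pointwise)
  qed
  obtain n where n: "m = Suc n" using m by (cases m) auto
  have "[:-q, 1:] ^ n dvd pderiv N"
  proof -
    have "[:-q, 1:] ^ n dvd pderiv ([:-q, 1:] ^ Suc n)"
      unfolding pderiv_power_Suc by (intro dvd_mult2 dvd_smult dvd_refl)
    moreover have "[:-q, 1:] ^ n dvd [:-q, 1:] ^ Suc n" by (rule le_imp_power_dvd) simp
    ultimately show ?thesis
      unfolding N_def n pderiv_smult pderiv_mult by (intro dvd_smult dvd_add dvd_mult dvd_mult2)
  qed
  moreover have "h dvd pderiv N"
  proof -
    have "pderiv N = pderiv (N - 1)" by (simp add: pderiv_diff)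
    also have "\<dots> = smult C' (root_poly S1 * (2 * h * pderiv h) + h\<^sup>2 * pderiv (root_poly S1))"
      unfolding N1 by (simp add: pderiv_smult pderiv_mult power2_eq_square algebra_simps)
    also have "h dvd \<dots>" by (intro dvd_smult dvd_add dvd_mult dvd_mult2)
        (simp_all add: power2_eq_square)
    finally show ?thesis .
  qed
  \<comment> \<open>At \<open>t = q\<close> the left side of \<open>id\<close> is \<open>-1\<close>,
    so \<open>h\<close> cannot vanish there.\<close>
  moreover have hq: "poly h q \<noteq> 0" using id[of q] m by (auto simp: zero_power)
  ultimately obtain r' where r': "pderiv N = h * r'" and un: "[:-q, 1:] ^ n dvd h * r'"
    by (metis dvdE)
  have "order q (h * r') = order q r'" if "r' \<noteq> 0"
    using that h hq by (simp add: order_mult order_0I)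
  hence "[:-q, 1:] ^ n dvd r'"
    using un h by (cases "r' = 0") (simp_all add: order_divides)
  then obtain r where "r' = [:-q, 1:] ^ n * r" by (rule dvdE)
  hence r: "pderiv N = [:-q, 1:] ^ n * h * r" using r' by (simp only: mult_ac)
  have degN: "degree N = card S0 + m"
    using C fin by (simp add: N_def degree_mult_eq degree_root_poly degree_power_eq)
  hence N': "pderiv N \<noteq> 0" using m by (simp add: pderiv_eq_0_iff)
  hence "r \<noteq> 0" using r by auto
  hence "degree (pderiv N) = n + card S0 + degree r"
    unfolding r using h by (simp add: degree_mult_eq degree_power_eq)
  hence "degree r = 0" using degN n by (simp add: degree_pderiv)
  then obtain K where K: "r = [:K:]" by (metis degree_eq_zeroE)
  hence "pderiv N = smult K ([:-q, 1:] ^ (m - 1) * h)" using r n by simp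
  moreover have "K \<noteq> 0" using K \<open>r \<noteq> 0\<close> by simp
  ultimately show ?thesis
    unfolding belyi_form_def N_def[symmetric] using C h N1 N_def by blast
qed

text \<open>The hypotheses of \<open>belyi_form_reduces\<close> at the normalized points.
  \<open>N\<close> is whichever of \<open>P\<close> and \<open>1 - P\<close> vanishes at
  \<open>p0\<close>.\<close>

definition case_data :: "subcase \<Rightarrow> (complex \<Rightarrow> complex) \<Rightarrow> bool" where
  "case_data k \<kappa> \<longleftrightarrow> (\<exists>S0 S1 m h N c c'. belyi_form S0 S1 (case_p0 k) m h N \<and> finite S0 \<and> finite S1 \<and>
     S0 \<inter> S1 = {} \<and> case_p0 k \<notin> S0 \<union> S1 \<and>
     (m = 2 \<and> {0, 1, case_D k} = insert (case_p0 k) (S0 \<union> S1) \<and> \<kappa> (case_p0 k) = 2 * c - 1 \<or>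
      m = 3 \<and> {0, 1, case_D k} = S0 \<union> S1 \<and> c = 2/3) \<and>
     (\<forall>d\<in>S0. \<kappa> d = c) \<and> (\<forall>d\<in>S1. \<kappa> d = c') \<and> (degree h = 0 \<or> c' = 1/2) \<and>
     (case_P k = poly N \<or> case_P k = (\<lambda>t. 1 - poly N t)))"

lemma case_dataI:
  assumes "finite S0" "finite S1" "C \<noteq> 0" "C' \<noteq> 0" "m > 0" "h \<noteq> 0" "degree h = card S0"
    and "\<And>t. C * ((\<Prod>d\<in>S0. t - d) * (t - case_p0 k) ^ m) - 1 = C' * ((\<Prod>d\<in>S1. t - d) * (poly h t)\<^sup>2)"
    and "S0 \<inter> S1 = {}" "case_p0 k \<notin> S0 \<union> S1"
    and "m = 2 \<and> {0, 1, case_D k} = insert (case_p0 k) (S0 \<union> S1) \<and> \<kappa> (case_p0 k) = 2 * c - 1 \<or>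
         m = 3 \<and> {0, 1, case_D k} = S0 \<union> S1 \<and> c = 2/3"
    and "\<And>d. d \<in> S0 \<Longrightarrow> \<kappa> d = c" "\<And>d. d \<in> S1 \<Longrightarrow> \<kappa> d = c'" "degree h = 0 \<or> c' = 1/2"
    and P: "(\<forall>t. case_P k t = C * ((\<Prod>d\<in>S0. t - d) * (t - case_p0 k) ^ m)) \<or>
            (\<forall>t. case_P k t = 1 - C * ((\<Prod>d\<in>S0. t - d) * (t - case_p0 k) ^ m))"
  shows "case_data k \<kappa>"
proof -
  have "poly (smult C (root_poly S0 * [:-case_p0 k, 1:] ^ m))
          = (\<lambda>t. C * ((\<Prod>d\<in>S0. t - d) * (t - case_p0 k) ^ m))"
    by (rule ext) (simp add: poly_root_poly)
  hence P': "case_P k = poly (smult C (root_poly S0 * [:-case_p0 k, 1:] ^ m)) \<or>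
        case_P k = (\<lambda>t. 1 - poly (smult C (root_poly S0 * [:-case_p0 k, 1:] ^ m)) t)"
    using P by (auto simp: fun_eq_iff)
  show ?thesis
    unfolding case_data_def
    by (rule exI[of _ S0], rule exI[of _ S1], rule exI[of _ m], rule exI[of _ h],
        rule exI[of _ "smult C (root_poly S0 * [:-case_p0 k, 1:] ^ m)"],
        rule exI[of _ c], rule exI[of _ c'], intro conjI ballI)
      (rule belyi_formI P' assms | assumption)+
qed

subsection \<open>The seven polynomials\<close>

lemma sqrt_square: "(\<i> * (complex_of_real (sqrt (real n)) / r))\<^sup>2 = - (of_nat n / r\<^sup>2)"
  by (simp add: power_mult_distrib power_divide flip: of_real_power)

text \<open>All constants are rational expressions in \<open>w\<close>. Keeping only the quadratic
  equation of \<open>w\<close> reduces the later computations to polynomial identities modulo that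
  equation, and \<open>Im w \<noteq> 0\<close> keeps the points distinct. The next two lemmas use
  the same device.\<close>

lemma case_2a_2d:
  obtains w :: complex where "12 * w\<^sup>2 + 1 = 0" "Im w \<noteq> 0"
    "case_p0 Case2a = 1/2 + w" "case_D Case2a = 1/2 + 3 * w"
    "case_p0 Case2d = 1/2 + w" "case_D Case2d = 1/2 + 3 * w"
    "\<And>t. case_P Case2a t = 18 * w * (t - (1/2 + w)) ^ 3"
    "\<And>t. case_P Case2d t = 1 - 108 * (t * (t - 1) * (t - (1/2 + 3 * w)) * (t - (1/2 + w)) ^ 3)"
proof -
  define w :: complex where "w = \<i> * (sqrt 3 / 6)"
  have w: "12 * w\<^sup>2 + 1 = 0" using sqrt_square[of 3 6] by (simp add: w_def)
  have nz: "1/2 + w \<noteq> 0" by (auto simp: w_def complex_eq_iff)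
  have P: "(1 - t / (1/2 + w)) ^ 3 = 18 * w * (t - (1/2 + w)) ^ 3" for t
  proof -
    have "1 - t / z = - (t - z) / z" if "z \<noteq> 0" for z using that by (simp add: field_simps)
    note this[OF nz]
    \<comment> \<open>The squared modulus of \<open>1/2 + w\<close> is \<open>1/3\<close>, so the
      inverse is three times the conjugate \<open>1/2 - w\<close>.\<close>
    also have "1 / (1/2 + w) = 3/2 - 3 * w" using nz w by (subst divide_eq_eq) (simp; algebra)
    hence "- (t - (1/2 + w)) / (1/2 + w) = - (t - (1/2 + w)) * (3/2 - 3 * w)"
      by (metis divide_inverse inverse_eq_divide)
    finally have "1 - t / (1/2 + w) = - (t - (1/2 + w)) * (3/2 - 3 * w)" .
    thus ?thesis using w by algebra
  qed
  show ?thesis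
  proof (rule that[of w])
    show "12 * w\<^sup>2 + 1 = 0" by fact
    show "Im w \<noteq> 0" by (simp add: w_def)
    show p: "case_p0 Case2a = 1/2 + w" "case_p0 Case2d = 1/2 + w"
      "case_D Case2a = 1/2 + 3 * w" "case_D Case2d = 1/2 + 3 * w"
      by (simp_all add: w_def)
    show "case_P Case2a t = 18 * w * (t - (1/2 + w)) ^ 3" for t
      using P[of t] p(1) by simp
    \<comment> \<open>With \<open>x\<close> for the cube this is \<open>1 - 4 x (1 - x)\<close>,
      where \<open>1 - x = - 18 w t (t - 1) (t - (1/2 + 3 w))\<close> and
      \<open>4 (18 w)^2 = -108\<close>.\<close>
    have "4 * ((1 - t / (1/2 + w)) ^ 3 - 1/2)\<^sup>2
            = 1 - 108 * (t * (t - 1) * (t - (1/2 + 3 * w)) * (t - (1/2 + w)) ^ 3)" for t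
      unfolding P using w by algebra
    thus "case_P Case2d t = 1 - 108 * (t * (t - 1) * (t - (1/2 + 3 * w)) * (t - (1/2 + w)) ^ 3)"
        for t
      using p(2) by simp
  qed
qed

lemma case_2b:
  obtains w :: complex where "8 * w\<^sup>2 + 1 = 0" "Im w \<noteq> 0"
    "case_p0 Case2b = 1/2 + w" "case_D Case2b = 1/2 + 5 * w"
    "\<And>t. case_P Case2b t = - (64/27) * ((t - (1/2 + 5 * w)) * (t - (1/2 + w)) ^ 3)"
proof -
  define w :: complex where "w = \<i> * (sqrt 2 / 4)"
  have w: "8 * w\<^sup>2 + 1 = 0" using sqrt_square[of 2 4] by (simp add: w_def)
  have nz: "1/2 + w \<noteq> 0" "1/2 + 5 * w \<noteq> 0" by (auto simp: w_def complex_eq_iff)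
  show ?thesis
  proof (rule that[of w])
    show "8 * w\<^sup>2 + 1 = 0" by fact
    show "Im w \<noteq> 0" by (simp add: w_def)
    show p: "case_p0 Case2b = 1/2 + w" "case_D Case2b = 1/2 + 5 * w"
      by (simp_all add: w_def)
    have "(1 - t / (1/2 + 5 * w)) * (1 - t / (1/2 + w)) ^ 3
            = ((t - (1/2 + 5 * w)) * (t - (1/2 + w)) ^ 3) / ((1/2 + 5 * w) * (1/2 + w) ^ 3)" for t
    proof -
      have "(1 - t / y) * (1 - t / z) ^ 3 = (t - y) * (t - z) ^ 3 / (y * z ^ 3)"
        if "y \<noteq> 0" "z \<noteq> 0" for y z
      proof -
        have "1 - t / y = - (t - y) / y" "1 - t / z = - (t - z) / z"
          using that by (simp_all add: field_simps)
        thus ?thesis by (simp only: power_divide) (simp add: power3_eq_cube del: minus_diff_eq)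
      qed
      from this[OF nz(2,1)] show ?thesis .
    qed
    moreover have "(1/2 + 5 * w) * (1/2 + w) ^ 3 = - (27/64)" using w by algebra
    moreover have "case_P Case2b t = (1 - t / case_D Case2b) * (1 - t / case_p0 Case2b) ^ 3" for t
      by (simp only: case_P.simps)
    ultimately show "case_P Case2b t = - (64/27) * ((t - (1/2 + 5 * w)) * (t - (1/2 + w)) ^ 3)"
        for t
      unfolding p by simp
  qed
qed

lemma case_2c:
  obtains w :: complex where "108 * w\<^sup>2 + 5 = 0" "Im w \<noteq> 0"
    "case_p0 Case2c = 1/2 + w" "case_D Case2c = 1/2 + 11/5 * w"
    "\<And>t. case_P Case2c t = - (18225/32) * w * (t * (t - 1) * (t - (1/2 + w)) ^ 3)"
proof -
  define w :: complex where "w = \<i> * (sqrt 15 / 18)"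
  have w: "108 * w\<^sup>2 + 5 = 0" using sqrt_square[of 15 18] by (simp add: w_def)
  show ?thesis
    by (rule that[of w]) (use w in \<open>simp_all add: w_def\<close>)
qed

text \<open>In each subcase \<open>S0\<close> consists of the points of \<open>0, 1, D\<close> that
  share the fibre of \<open>p0\<close>, apart from \<open>p0\<close> itself, and \<open>h\<close> is
  found by factoring \<open>N - 1\<close>; \<open>c\<close> and \<open>c'\<close> are read off the
  condition on \<open>\<kappa>\<close>.\<close>

lemma case_condition_imp_case_data:
  assumes "case_condition k \<kappa>"
  shows "case_data k \<kappa>"
proof (cases k)
  case Case1a
  \<comment> \<open>\<open>N = (t - 1)^2 = 1 - P\<close>, and \<open>c\<close> solves
    \<open>\<kappa> 1 = 2 c - 1\<close>.\<close>
  show ?thesis unfolding Case1a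
    by (rule case_dataI[of "{}" "{0, 2}" 1 1 2 1 _ _ "(\<kappa> 1 + 1) / 2" "\<kappa> 0"])
      (use assms in \<open>auto simp: Case1a algebra_simps power2_eq_square\<close>)
next
  case Case1b
  \<comment> \<open>\<open>N = P\<close> and \<open>P - 1 = - 1/4 t (t - 3)^2\<close>, so 3 is the
    double point over 1.\<close>
  show ?thesis unfolding Case1b
    by (rule case_dataI[of "{4}" "{0}" "-1/4" "-1/4" 2 "[:-3, 1:]" _ _ "\<kappa> 4" "1/2"])
      (use assms in \<open>auto simp: Case1b field_simps power2_eq_square\<close>)
next
  case Case1c
  \<comment> \<open>\<open>N = 1 - P\<close>, so
    \<open>N - 1 = - P = -4 (t^2 - 2 t + 1/2)^2\<close>.\<close>
  show ?thesis unfolding Case1c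
    by (rule case_dataI[of "{0, 2}" "{}" "-4" "-4" 2 "[:1/2, -2, 1:]" _ _ "\<kappa> 0" "1/2"])
      (use assms in \<open>auto simp: Case1c field_simps power2_eq_square\<close>)
next
  case Case2a
  obtain w :: complex where w: "12 * w\<^sup>2 + 1 = 0" "Im w \<noteq> 0"
    and D: "case_p0 Case2a = 1/2 + w" "case_D Case2a = 1/2 + 3 * w"
    and P: "\<And>t. case_P Case2a t = 18 * w * (t - (1/2 + w)) ^ 3"
    using case_2a_2d by metis
  have ne: "1/2 + 3 * w \<noteq> 0" "1/2 + 3 * w \<noteq> 1" "1/2 + w \<noteq> 0" "1/2 + w \<noteq> 1" "w \<noteq> 0"
    using w(2) by (auto simp: complex_eq_iff)
  have id: "18 * w * (t - (1/2 + w)) ^ 3 - 1 = 18 * w * (t * ((t - 1) * (t - (1/2 + 3 * w))))" for t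
    using w(1) by algebra
  show ?thesis unfolding Case2a
    by (rule case_dataI[of "{}" "{0, 1, 1/2 + 3 * w}" "18 * w" "18 * w" 3 1 _ _ "2/3" "\<kappa> 0"])
      (use assms ne w(2) id in \<open>auto simp: Case2a D P simp del: case_p0.simps case_D.simps
          case_P.simps\<close>)
next
  case Case2b
  obtain w :: complex where w: "8 * w\<^sup>2 + 1 = 0" "Im w \<noteq> 0"
    and D: "case_p0 Case2b = 1/2 + w" "case_D Case2b = 1/2 + 5 * w"
    and P: "\<And>t. case_P Case2b t = - (64/27) * ((t - (1/2 + 5 * w)) * (t - (1/2 + w)) ^ 3)"
    using case_2b by metis
  have ne: "1/2 + 5 * w \<noteq> 0" "1/2 + 5 * w \<noteq> 1" "1/2 + w \<noteq> 0" "1/2 + w \<noteq> 1" "w \<noteq> 0"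
    using w(2) by (auto simp: complex_eq_iff)
  \<comment> \<open>The double point \<open>1/2 + 4 w\<close> over 1 comes from equating the sums of
    roots of \<open>N\<close> and \<open>N - 1\<close>.\<close>
  have id: "- (64/27) * ((t - (1/2 + 5 * w)) * (t - (1/2 + w)) ^ 3) - 1
      = - (64/27) * ((t * (t - 1)) * (- (1/2 + 4 * w) + t)\<^sup>2)" for t
    using w(1) by algebra
  show ?thesis unfolding Case2b
    by (rule case_dataI[of "{1/2 + 5 * w}" "{0, 1}" "-(64/27)" "-(64/27)" 3
        "[:-(1/2 + 4 * w), 1:]" _ _ "2/3" "1/2"])
      (use assms ne w(2) id in \<open>auto simp: Case2b D P simp del: case_p0.simps case_D.simps
          case_P.simps\<close>)
next
  case Case2c
  obtain w :: complex where w: "108 * w\<^sup>2 + 5 = 0" "Im w \<noteq> 0"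
    and D: "case_p0 Case2c = 1/2 + w" "case_D Case2c = 1/2 + 11/5 * w"
    and P: "\<And>t. case_P Case2c t = - (18225/32) * w * (t * (t - 1) * (t - (1/2 + w)) ^ 3)"
    using case_2c by metis
  have ne: "1/2 + 11/5 * w \<noteq> 0" "1/2 + 11/5 * w \<noteq> 1" "1/2 + w \<noteq> 0" "1/2 + w \<noteq> 1" "w \<noteq> 0"
    using w(2) by (auto simp: complex_eq_iff)
  \<comment> \<open>In \<open>u = t - (1/2 + w)\<close> this is
    \<open>u^2 + 8/5 w u + 96/25 w^2\<close>, the quadratic \<open>u^2 + f u + g\<close> of
    \<open>classify_2c\<close> for \<open>z = 6/5 w\<close>.\<close>
  define h where "h = [:(1/2 + w)\<^sup>2 - 8/5 * w * (1/2 + w) + 96/25 * w\<^sup>2,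
      8/5 * w - 2 * (1/2 + w), 1:]"
  have id: "- (18225/32) * w * (t * (t - 1) * (t - (1/2 + w)) ^ 3) - 1
      = - (18225/32) * w * ((t - (1/2 + 11/5 * w)) * (poly h t)\<^sup>2)" for t
    unfolding h_def poly_pCons poly_0 using w(1) by algebra
  have h: "h \<noteq> 0" "degree h = 2" by (simp_all add: h_def)
  show ?thesis unfolding Case2c
    by (rule case_dataI[of "{0, 1}" "{1/2 + 11/5 * w}" "- (18225/32) * w"
        "- (18225/32) * w" 3 h _ _ "2/3" "1/2"])
      (use assms ne w(2) id h in \<open>auto simp: Case2c D P simp del: case_p0.simps case_D.simps
          case_P.simps\<close>)
next
  case Case2d
  obtain w :: complex where w: "12 * w\<^sup>2 + 1 = 0" "Im w \<noteq> 0"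
    and D: "case_p0 Case2d = 1/2 + w" "case_D Case2d = 1/2 + 3 * w"
    and P: "\<And>t. case_P Case2d t
        = 1 - 108 * (t * (t - 1) * (t - (1/2 + 3 * w)) * (t - (1/2 + w)) ^ 3)"
    using case_2a_2d by metis
  have ne: "1/2 + 3 * w \<noteq> 0" "1/2 + 3 * w \<noteq> 1" "1/2 + w \<noteq> 0" "1/2 + w \<noteq> 1" "w \<noteq> 0"
    using w(2) by (auto simp: complex_eq_iff)
  \<comment> \<open>With \<open>v = (t - (1/2 + w))^3\<close>, \<open>P\<close> is
    \<open>4 (18 w v - 1/2)^2\<close>, whose root is \<open>v = 1 / (36 w) = - w/3\<close>.\<close>
  define h where "h = [:w/3 - (1/2 + w) ^ 3, 3 * (1/2 + w)\<^sup>2, - 3 * (1/2 + w), 1:]"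
  have ht: "poly h t = (t - (1/2 + w)) ^ 3 + w/3" for t
    by (simp add: h_def power3_eq_cube power2_eq_square algebra_simps)
  have "t * (t - 1) * (t - (1/2 + 3 * w)) = (t - (1/2 + w)) ^ 3 + 2 * (w/3)" for t
    using w(1) by algebra
  moreover have "108 * ((x + 2 * (w/3)) * x) - 1 = 108 * (x + w/3)\<^sup>2" for x
  proof -
    have "108 * (x + w/3)\<^sup>2 = 108 * ((x + 2 * (w/3)) * x) + (12 * w\<^sup>2 + 1) - 1"
      by (simp add: power2_eq_square algebra_simps)
    thus ?thesis unfolding w(1) by simp
  qed
  ultimately have id: "108 * (t * (t - 1) * (t - (1/2 + 3 * w)) * (t - (1/2 + w)) ^ 3) - 1
      = 108 * (poly h t)\<^sup>2" for t
    unfolding ht by simp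
  have h: "h \<noteq> 0" "degree h = 3" by (simp_all add: h_def)
  show ?thesis unfolding Case2d
    by (rule case_dataI[of "{0, 1, 1/2 + 3 * w}" "{}" 108 108 3 h _ _ "2/3" "1/2"])
      (use assms ne w(2) id h in \<open>auto simp: Case2d D P mult.assoc simp del: case_p0.simps
          case_D.simps case_P.simps\<close>)
qed

subsection \<open>Determination of the seven subcases\<close>

lemma affine_bij:
  assumes "complex_affine B"
  shows "bij B"
proof -
  obtain m n where mn: "m \<noteq> 0" "B = (\<lambda>s. m * s + n)"
    using assms unfolding complex_affine_def by blast
  show ?thesis
    by (rule bij_betw_byWitness[of _ "\<lambda>t. (t - n) / m"]) (use mn in \<open>auto simp: field_simps\<close>)
qed

text \<open>The description of the reducing \<open>R\<close> in the theorem, with \<open>q\<close>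
  in place of \<open>q' / (\<alpha> * \<beta>)\<close>.\<close>

definition classified ::
  "complex set \<Rightarrow> (complex \<Rightarrow> complex) \<Rightarrow> complex \<Rightarrow> (complex \<Rightarrow> complex) \<Rightarrow> bool" where
  "classified S \<kappa> q R \<longleftrightarrow>
     (\<exists>B k. complex_affine B \<and> B ` S = {0, 1, case_D k} \<and> case_condition k (\<lambda>x. \<kappa> (inv B x)) \<and>
        q = inv B (case_p0 k) \<and>
        (R = (\<lambda>s. case_P k (B s)) \<or> R = (\<lambda>s. 1 - case_P k (B s))))"

text \<open>In the coordinate \<open>u = s - q\<close> the affine map of slope \<open>\<mu>\<close>
  taking \<open>q\<close> to \<open>p0\<close> is \<open>p0 + \<mu> u\<close>. Asking for the
  condition at every \<open>\<kappa>'\<close> with the right three values keeps \<open>inv B\<close>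
  out of the computations.\<close>

lemma classifiedI:
  assumes "\<mu> \<noteq> 0" and S: "S = {q + x, q + y, q + z}"
    and B: "case_p0 k + \<mu> * x = 0" "case_p0 k + \<mu> * y = 1" "case_p0 k + \<mu> * z = case_D k"
    and cond: "\<And>\<kappa>'. \<kappa>' 0 = \<kappa> (q + x) \<Longrightarrow> \<kappa>' 1 = \<kappa> (q + y) \<Longrightarrow> \<kappa>' (case_D k) = \<kappa> (q + z) \<Longrightarrow>
                 case_condition k \<kappa>'"
    and R: "(\<forall>u. R (q + u) = case_P k (case_p0 k + \<mu> * u)) \<or>
            (\<forall>u. R (q + u) = 1 - case_P k (case_p0 k + \<mu> * u))"
  shows "classified S \<kappa> q R"
proof -
  define B where "B = (\<lambda>s. \<mu> * s + (case_p0 k - \<mu> * q))"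
  have Bq: "B (q + u) = case_p0 k + \<mu> * u" for u by (simp add: B_def algebra_simps)
  have aff: "complex_affine B" unfolding complex_affine_def B_def using assms(1) by blast
  have inv: "inv B (B s) = s" for s using affine_bij[OF aff] by (simp add: bij_is_inj)
  have "B ` S = {0, 1, case_D k}" unfolding S by (simp add: Bq B)
  moreover have "case_condition k (\<lambda>x. \<kappa> (inv B x))"
    using inv[of "q + x"] inv[of "q + y"] inv[of "q + z"] by (intro cond) (simp_all add: Bq B)
  moreover have "q = inv B (case_p0 k)" using inv[of q] Bq[of 0] by simp
  moreover have "R = (\<lambda>s. case_P k (B s)) \<or> R = (\<lambda>s. 1 - case_P k (B s))"
    using R
  proof
    assume "\<forall>u. R (q + u) = case_P k (case_p0 k + \<mu> * u)"
    hence "R s = case_P k (B s)" for s using Bq[of "s - q"]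
        by (metis add_diff_cancel_left' add_diff_eq)
    thus ?thesis by blast
  next
    assume "\<forall>u. R (q + u) = 1 - case_P k (case_p0 k + \<mu> * u)"
    hence "R s = 1 - case_P k (B s)" for s using Bq[of "s - q"]
        by (metis add_diff_cancel_left' add_diff_eq)
    thus ?thesis by blast
  qed
  ultimately show ?thesis unfolding classified_def using aff by blast
qed

lemma monic_pCons:
  assumes "degree p = Suc n" "lead_coeff p = 1"
  obtains a p' where "p = pCons a p'" "degree p' = n" "lead_coeff p' = 1"
proof (cases p)
  case (pCons a p')
  with assms that show ?thesis by (auto split: if_splits)
qed

lemma monic_degree_0: "degree p = 0 \<Longrightarrow> lead_coeff p = 1 \<Longrightarrow> p = 1"
  for p :: "complex poly"
  by (metis degree_eq_zeroE coeff_pCons_0 one_pCons)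

lemma monic_degree_1:
  fixes p :: "complex poly"
  assumes "degree p = 1" "lead_coeff p = 1"
  obtains a where "p = [:a, 1:]"
  using assms monic_pCons[of p 0] monic_degree_0 by (metis One_nat_def one_pCons)

lemma monic_degree_2:
  fixes p :: "complex poly"
  assumes "degree p = 2" "lead_coeff p = 1"
  obtains a b where "p = [:a, b, 1:]"
  using assms monic_pCons[of p 1] monic_degree_1 by (metis Suc_1)

lemma monic_degree_3:
  fixes p :: "complex poly"
  assumes "degree p = 3" "lead_coeff p = 1"
  obtains a b c where "p = [:a, b, c, 1:]"
proof -
  obtain a p' where "p = pCons a p'" "degree p' = 2" "lead_coeff p' = 1"
    using monic_pCons[of p 2] assms by auto
  with that show ?thesis using monic_degree_2[of p'] by metis
qed

section \<open>Comparison of coefficients in the seven cases\<close>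

lemma sum_prod_unique:
  fixes x y a b :: complex
  assumes "x + y = a + b" "x * y = a * b"
  shows "x = a \<and> y = b \<or> x = b \<and> y = a"
proof -
  have "(x - a) * (x - b) = 0" using assms by algebra
  thus ?thesis using assms by auto
qed

text \<open>The new coordinate is \<open>u = s - q\<close>, and \<open>r = 1 / C\<close> makes both sides monic.\<close>

lemma reduction_data_shift:
  assumes data: "reduction_data S \<kappa> q N" and S: "finite S"
  obtains E0 E1 g r C m c c' where
    "m = (if q \<in> S then 2 else 3)" "C * r = 1" "finite E0" "finite E1"
    "S = (+) q ` (E0 \<union> E1) \<union> (if m = 2 then {q} else {})"
    "\<And>u. (\<Prod>e\<in>E0. u - e) * u ^ m - r = (\<Prod>e\<in>E1. u - e) * (poly g u)\<^sup>2"
    "\<And>u. poly N (q + u) = C * ((\<Prod>e\<in>E0. u - e) * u ^ m)"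
    "lead_coeff g = 1" "degree g = card E0" "card E0 + card E1 = m"
    "\<And>e. e \<in> E0 \<Longrightarrow> \<kappa> (q + e) = c" "\<And>e. e \<in> E1 \<Longrightarrow> \<kappa> (q + e) = c'"
    "m = 2 \<Longrightarrow> \<kappa> q = 2 * c - 1" "m = 3 \<Longrightarrow> c = 2/3" "degree g = 0 \<or> c' = 1/2"
proof -
  obtain S0 S1 h C m c c' where m: "m = (if q \<in> S then 2 else 3)" and S01: "S0 \<union> S1 = S - {q}"
    and "S0 \<inter> S1 = {}" and C: "C \<noteq> 0"
    and N: "N = smult C (root_poly S0 * [:-q, 1:] ^ m)" "N - 1 = smult C (root_poly S1 * h\<^sup>2)"
    and h: "lead_coeff h = 1" "degree h = card S0" "card S0 + card S1 = m"
    and c: "\<forall>d\<in>S0. \<kappa> d = c" "\<forall>d\<in>S1. \<kappa> d = c'" "q \<in> S \<longrightarrow> \<kappa> q = 2 * c - 1" "q \<notin> S \<longrightarrow> c = 2/3"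
      "degree h = 0 \<or> c' = 1/2"
    using data unfolding reduction_data_def by (elim exE conjE) (rule that, assumption+)
  have fin: "finite S0" "finite S1" using S S01 by (metis finite_Diff finite_Un)+
  define g where "g = pcompose h [:q, 1:]"
  have "lead_coeff g = lead_coeff h * lead_coeff [:q, 1:] ^ degree h"
    unfolding g_def by (rule lead_coeff_comp) simp
  hence g: "lead_coeff g = 1" "degree g = degree h"
    using h(1) by (simp_all add: g_def degree_pcompose)
  define sh where "sh = (\<lambda>d. d - q)"
  have inj: "inj_on sh A" for A by (auto simp: sh_def inj_on_def)
  have pr: "(\<Prod>e\<in>sh ` A. u - e) = (\<Prod>d\<in>A. q + u - d)" for A u
    by (subst prod.reindex[OF inj]) (simp add: sh_def algebra_simps)
  have Nu: "poly N (q + u) = C * ((\<Prod>e\<in>sh ` S0. u - e) * u ^ m)" for u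
    unfolding pr using arg_cong[OF N(1), of "\<lambda>p. poly p (q + u)"] by (simp add: poly_root_poly)
  show ?thesis
  proof (rule that[OF m])
    show "C * (1 / C) = 1" using C by simp
    show "finite (sh ` S0)" "finite (sh ` S1)" using fin by auto
    show "S = (+) q ` (sh ` S0 \<union> sh ` S1) \<union> (if m = 2 then {q} else {})"
      unfolding image_Un image_image using S01 by (auto simp: sh_def m)
    show "(\<Prod>e\<in>sh ` S0. u - e) * u ^ m - 1 / C = (\<Prod>e\<in>sh ` S1. u - e) * (poly g u)\<^sup>2" for u
    proof -
      have "C * ((\<Prod>e\<in>sh ` S0. u - e) * u ^ m) - 1 = C * ((\<Prod>e\<in>sh ` S1. u - e) * (poly g u)\<^sup>2)"
        unfolding Nu[symmetric] unfolding pr using arg_cong[OF N(2), of "\<lambda>p. poly p (q + u)"]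
        by (simp add: poly_root_poly g_def poly_pcompose)
      thus ?thesis using C by (simp add: field_simps)
    qed
    show "lead_coeff g = 1" by fact
    show "degree g = card (sh ` S0)" "card (sh ` S0) + card (sh ` S1) = m"
      using g h by (simp_all add: card_image[OF inj])
    show "\<kappa> (q + e) = c" if "e \<in> sh ` S0" for e using that c by (auto simp: sh_def)
    show "\<kappa> (q + e) = c'" if "e \<in> sh ` S1" for e using that c by (auto simp: sh_def)
    show "degree g = 0 \<or> c' = 1/2" using g c by simp
  qed (use Nu c m in \<open>auto split: if_splits\<close>)
qed

text \<open>\<open>-1/2 + 3 w\<close> and \<open>-1/2 - 3 w\<close> are the primitive cube roots of
  unity, and \<open>x, y, z\<close> are the roots of \<open>X^3 = x y z\<close>.\<close>

lemma equilateral_roots: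
  fixes w x y z :: complex
  assumes w: "12 * w\<^sup>2 + 1 = 0" and "x + y + z = 0" "x * y + x * z + y * z = 0"
  obtains "y = (-1/2 + 3 * w) * x" "z = (-1/2 - 3 * w) * x"
  | "z = (-1/2 + 3 * w) * x" "y = (-1/2 - 3 * w) * x"
proof -
  have "y + z = (-1/2 + 3 * w) * x + (-1/2 - 3 * w) * x" using assms by algebra
  moreover have "y * z = ((-1/2 + 3 * w) * x) * ((-1/2 - 3 * w) * x)" using assms by algebra
  ultimately show ?thesis using sum_prod_unique that by blast
qed

text \<open>The coefficient of \<open>u\<close> gives \<open>y = - x\<close>. As in the other six
  cases, the coefficients determine the points up to scale, \<open>r \<noteq> 0\<close> excludes
  degenerate solutions, and an element \<open>i\<close> inverse to the scale replaces division in
  the algebra.\<close>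

lemma classify_1a:
  assumes id: "\<And>u :: complex. u ^ 2 - r = (u - x) * (u - y)" "r * C = 1" "S = {q, q + x, q + y}"
    "\<kappa> (q + x) = c'" "\<kappa> (q + y) = c'" "\<And>u. R (q + u) = C * u\<^sup>2"
  shows "classified S \<kappa> q R"
proof -
  have eq: "[:-r, 0, 1:] = [:x * y, -(x + y), 1:]"
  proof (rule poly_eqI_pointwise)
    fix u
    have "poly [:-r, 0, 1:] u = u ^ 2 - r" by (simp add: algebra_simps eval_nat_numeral)
    also have "\<dots> = (u - x) * (u - y)" by (rule id)
    also have "\<dots> = poly [:x * y, -(x + y), 1:] u" by (simp add: algebra_simps eval_nat_numeral)
    finally show "poly [:-r, 0, 1:] u = poly [:x * y, -(x + y), 1:] u" .
  qed
  have cf: "-r = x * y" "0 = -(x + y)"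
    using eq unfolding pCons_eq_iff by - (elim conjE, assumption)+
  have e: "r = -(x * y)" "x + y = 0"
    using cf by - (assumption | algebra)+
  hence y: "y = -x" by algebra
  have x: "x \<noteq> 0" using e assms(2) by auto
  define i where "i = 1 / x"
  have ix: "i * x = 1" using x by (simp add: i_def)
  have C: "C = i\<^sup>2" using assms(2) e y ix by algebra
  \<comment> \<open>The slope \<open>-i\<close> sends \<open>q + x\<close> to 0, and
    \<open>t (2 - t) = 1 - (t - 1)^2\<close> makes \<open>R\<close> equal to \<open>1 - P\<close>
    after \<open>B\<close>.\<close>
  show ?thesis
    by (rule classifiedI[of "-i" _ _ x 0 y Case1a])
      (use assms C ix in \<open>auto simp: y power2_eq_square algebra_simps\<close>)
qed

text \<open>The coefficient of \<open>u\<close> gives \<open>f = 2 y\<close>, and that of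
  \<open>u^2\<close> then \<open>x = - 3 y\<close>; so \<open>y, 0, x\<close> correspond to
  \<open>0, 1, 4\<close>.\<close>

lemma classify_1b:
  assumes id: "\<And>u :: complex. (u - x) * u ^ 2 - r = (u - y) * (f + u)\<^sup>2"
    and "r * C = 1" "S = {q, q + x, q + y}"
    "\<kappa> q = 2 * c - 1" "\<kappa> (q + x) = c" "\<kappa> (q + y) = 1/2" "\<And>u. R (q + u) = C * ((u - x) * u\<^sup>2)"
  shows "classified S \<kappa> q R"
proof -
  have eq: "[:-r, 0, -x, 1:] = [:-y * f\<^sup>2, f\<^sup>2 - 2 * f * y, 2 * f - y, 1:]"
  proof (rule poly_eqI_pointwise)
    fix u
    have "poly [:-r, 0, -x, 1:] u = (u - x) * u ^ 2 - r"
        by (simp add: algebra_simps eval_nat_numeral)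
    also have "\<dots> = (u - y) * (f + u)\<^sup>2" by (rule id)
    also have "\<dots> = poly [:-y * f\<^sup>2, f\<^sup>2 - 2 * f * y, 2 * f - y, 1:] u"
        by (simp add: algebra_simps eval_nat_numeral)
    finally show "poly [:-r, 0, -x, 1:] u = poly [:-y * f\<^sup>2, f\<^sup>2 - 2 * f * y, 2 * f - y, 1:] u" .
  qed
  have cf: "-r = -y * f\<^sup>2" "0 = f\<^sup>2 - 2 * f * y" "-x = 2 * f - y"
    using eq unfolding pCons_eq_iff by - (elim conjE, assumption)+
  have e: "r = y * f\<^sup>2" "f * (f - 2 * y) = 0" "-x = 2 * f - y"
    using cf by - (assumption | algebra)+
  have "f \<noteq> 0" "y \<noteq> 0" using e(1) assms(2) by auto
  hence f: "f = 2 * y" using e(2) by simp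
  have x: "x = - 3 * y" using e(3) f by algebra
  define i where "i = 1 / y"
  have ix: "i * y = 1" using \<open>y \<noteq> 0\<close> by (simp add: i_def)
  have C: "C = 1/4 * i ^ 3" using assms(2) e(1) f ix by algebra
  have R: "R (q + u) = case_P Case1b (case_p0 Case1b + (-i) * u)" for u
  proof -
    have "C * ((u - x) * u\<^sup>2) = (1 + (-i) * u - 1)\<^sup>2 * (1 - 1/4 * (1 + (-i) * u))"
      using C ix x by algebra
    thus ?thesis using assms(7) by simp
  qed
  show ?thesis
    by (rule classifiedI[of "-i" _ _ y 0 x Case1b])
      (use assms(3-6) R ix \<open>y \<noteq> 0\<close> in \<open>auto simp: x i_def simp del: case_P.simps\<close>)
qed

text \<open>The coefficient of \<open>u\<close> is \<open>2 f g\<close> with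
  \<open>g \<noteq> 0\<close>, so \<open>f = 0\<close> and the points \<open>x, y\<close> are
  symmetric about \<open>q\<close>.\<close>

lemma classify_1c:
  assumes id: "\<And>u :: complex. (u - x) * (u - y) * u ^ 2 - r = (g + u * (f + u))\<^sup>2"
    and "r * C = 1" "S = {q, q + x, q + y}"
    "\<kappa> q = 2 * c - 1" "\<kappa> (q + x) = c" "\<kappa> (q + y) = c"
        "\<And>u. R (q + u) = C * ((u - x) * (u - y) * u\<^sup>2)"
  shows "classified S \<kappa> q R"
proof -
  have eq: "[:-r, 0, x * y, -(x + y), 1:] = [:g\<^sup>2, 2 * f * g, f\<^sup>2 + 2 * g, 2 * f, 1:]"
  proof (rule poly_eqI_pointwise)
    fix u
    have "poly [:-r, 0, x * y, -(x + y), 1:] u = (u - x) * (u - y) * u ^ 2 - r"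
        by (simp add: algebra_simps eval_nat_numeral)
    also have "\<dots> = (g + u * (f + u))\<^sup>2" by (rule id)
    also have "\<dots> = poly [:g\<^sup>2, 2 * f * g, f\<^sup>2 + 2 * g, 2 * f, 1:] u"
        by (simp add: algebra_simps eval_nat_numeral)
    finally show "poly [:-r, 0, x * y, -(x + y), 1:] u
        = poly [:g\<^sup>2, 2 * f * g, f\<^sup>2 + 2 * g, 2 * f, 1:] u" .
  qed
  have cf: "-r = g\<^sup>2" "0 = 2 * f * g" "x * y = f\<^sup>2 + 2 * g" "-(x + y) = 2 * f"
    using eq unfolding pCons_eq_iff by - (elim conjE, assumption)+
  have e: "-r = g\<^sup>2" "f * g = 0" "x * y = f\<^sup>2 + 2 * g" "-(x + y) = 2 * f"
    using cf by - (assumption | algebra)+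
  have "g \<noteq> 0" using e(1) assms(2) by auto
  hence f: "f = 0" using e(2) by simp
  have y: "y = - x" using e(4) f by algebra
  have g: "2 * g = - x\<^sup>2" using e(3) f y by algebra
  have x: "x \<noteq> 0" using g \<open>g \<noteq> 0\<close> by auto
  define i where "i = 1 / x"
  have ix: "i * x = 1" using x by (simp add: i_def)
  have C: "C = -4 * i ^ 4" using assms(2) e(1) g ix by algebra
  have R: "R (q + u) = 1 - case_P Case1c (case_p0 Case1c + (-i) * u)" for u
  proof -
    have "C * ((u - x) * (u - y) * u\<^sup>2) = 1 - 4 * ((1 - i * u) * (1 + i * u) - 1/2)\<^sup>2"
      using C ix y by algebra
    thus ?thesis using assms(7) by simp
  qed
  show ?thesis
    by (rule classifiedI[of "-i" _ _ x 0 y Case1c])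
      (use assms(3-6) R ix x in \<open>auto simp: y i_def simp del: case_P.simps\<close>)
qed

text \<open>The roots of \<open>u^3 = r\<close> form an equilateral triangle centred at
  \<open>q\<close>.\<close>

lemma classify_2a:
  assumes id: "\<And>u :: complex. u ^ 3 - r = (u - x) * (u - y) * (u - z)"
    and "r * C = 1" "S = {q + x, q + y, q + z}"
    "\<kappa> (q + x) = c'" "\<kappa> (q + y) = c'" "\<kappa> (q + z) = c'" "\<And>u. R (q + u) = C * u ^ 3"
  shows "classified S \<kappa> q R"
proof -
  have eq: "[:-r, 0, 0, 1:] = [:- (x * y * z), x * y + x * z + y * z, - (x + y + z), 1:]"
  proof (rule poly_eqI_pointwise)
    fix u
    have "poly [:-r, 0, 0, 1:] u = u ^ 3 - r" by (simp add: algebra_simps eval_nat_numeral)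
    also have "\<dots> = (u - x) * (u - y) * (u - z)" by (rule id)
    also have "\<dots> = poly [:- (x * y * z), x * y + x * z + y * z, - (x + y + z), 1:] u"
        by (simp add: algebra_simps eval_nat_numeral)
    finally show "poly [:-r, 0, 0, 1:] u
        = poly [:- (x * y * z), x * y + x * z + y * z, - (x + y + z), 1:] u" .
  qed
  have cf: "-r = - (x * y * z)" "0 = x * y + x * z + y * z" "0 = - (x + y + z)"
    using eq unfolding pCons_eq_iff by - (elim conjE, assumption)+
  have e: "r = x * y * z" "x + y + z = 0" "x * y + x * z + y * z = 0"
    using cf by - (assumption | algebra)+
  obtain w :: complex where w: "12 * w\<^sup>2 + 1 = 0" "Im w \<noteq> 0"
    and D: "case_p0 Case2a = 1/2 + w" "case_D Case2a = 1/2 + 3 * w"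
    and P: "\<And>t. case_P Case2a t = 18 * w * (t - (1/2 + w)) ^ 3"
    using case_2a_2d by metis
  have x: "x \<noteq> 0" using e(1) assms(2) by auto
  define i where "i = 1 / x"
  have ix: "i * x = 1" using x by (simp add: i_def)
  have "r = x ^ 3" using e by algebra
  hence C: "C = i ^ 3" using assms(2) ix by algebra
  \<comment> \<open>Forced by sending \<open>x\<close> to 0 and \<open>q\<close> to
    \<open>1/2 + w\<close>.\<close>
  define \<mu> where "\<mu> = - (1/2 + w) * i"
  have "1/2 + w \<noteq> 0" "w \<noteq> 0" using w(2) by (auto simp: complex_eq_iff)
  hence \<mu>: "\<mu> \<noteq> 0" using ix by (auto simp: \<mu>_def)
  have "18 * w * (1/2 + w) ^ 3 = -1" using w(1) by algebra
  hence R: "R (q + u) = case_P Case2a (case_p0 Case2a + \<mu> * u)" for u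
    unfolding assms(7) P D \<mu>_def C by algebra
  \<comment> \<open>The other two vertices go to \<open>1\<close> and \<open>1/2 + 3 w\<close> in an
    order not known beforehand, so \<open>a\<close> and \<open>b\<close> are named by their
    targets.\<close>
  have *: "classified S \<kappa> q R" if "S = {q + x, q + a, q + b}" "\<kappa> (q + a) = c'" "\<kappa> (q + b) = c'"
      and ab: "a = (-1/2 + 3 * w) * x" "b = (-1/2 - 3 * w) * x" for a b
  proof -
    have "1/2 + w + \<mu> * x = 0" "1/2 + w + \<mu> * a = 1" "1/2 + w + \<mu> * b = 1/2 + 3 * w"
      using ix ab w(1) unfolding \<mu>_def by algebra+
    thus ?thesis
      by (intro classifiedI[of \<mu> _ _ x a b Case2a])
        (use \<mu> that assms(4) R in \<open>auto simp: D simp del: case_p0.simps case_D.simps case_P.simps\<close>)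
  qed
  from w(1) e(2,3) show ?thesis
    by (rule equilateral_roots) (use * assms(3,5,6) in \<open>auto simp: insert_commute\<close>)
qed

text \<open>The coefficients of \<open>u\<close> and \<open>u^2\<close> give \<open>g = 0\<close>
  and then \<open>f = 0\<close>, since \<open>h \<noteq> 0\<close>. This leaves the symmetric
  functions of an equilateral triangle and \<open>x^3 = - 2 h\<close>.\<close>

lemma classify_2d:
  assumes id: "\<And>u :: complex. (u - x) * (u - y) * (u - z) * u ^ 3 - r
      = (h + u * (g + u * (f + u)))\<^sup>2"
    and "r * C = 1" "S = {q + x, q + y, q + z}"
    "\<kappa> (q + x) = 2/3" "\<kappa> (q + y) = 2/3" "\<kappa> (q + z) = 2/3"
    "\<And>u. R (q + u) = C * ((u - x) * (u - y) * (u - z) * u ^ 3)"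
  shows "classified S \<kappa> q R"
proof -
  have eq: "[:-r, 0, 0, - (x * y * z), x * y + x * z + y * z, - (x + y + z), 1:]
      = [:h\<^sup>2, 2 * g * h, g\<^sup>2 + 2 * f * h, 2 * h + 2 * f * g, f\<^sup>2 + 2 * g, 2 * f, 1:]"
  proof (rule poly_eqI_pointwise)
    fix u
    have "poly [:-r, 0, 0, - (x * y * z), x * y + x * z + y * z, - (x + y + z), 1:] u
        = (u - x) * (u - y) * (u - z) * u ^ 3 - r" by (simp add: algebra_simps eval_nat_numeral)
    also have "\<dots> = (h + u * (g + u * (f + u)))\<^sup>2" by (rule id)
    also have "\<dots> = poly [:h\<^sup>2, 2 * g * h, g\<^sup>2 + 2 * f * h, 2 * h + 2 * f * g, f\<^sup>2 + 2 * g,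
        2 * f, 1:] u" by (simp add: algebra_simps eval_nat_numeral)
    finally show "poly [:-r, 0, 0, - (x * y * z), x * y + x * z + y * z, - (x + y + z), 1:] u
        = poly [:h\<^sup>2, 2 * g * h, g\<^sup>2 + 2 * f * h, 2 * h + 2 * f * g, f\<^sup>2 + 2 * g, 2 * f, 1:] u" .
  qed
  have cf: "-r = h\<^sup>2" "0 = 2 * g * h" "0 = g\<^sup>2 + 2 * f * h" "- (x * y * z) = 2 * h + 2 * f * g"
      "x * y + x * z + y * z = f\<^sup>2 + 2 * g" "- (x + y + z) = 2 * f"
    using eq unfolding pCons_eq_iff by - (elim conjE, assumption)+
  have e: "-r = h\<^sup>2" "g * h = 0" "g\<^sup>2 + 2 * f * h = 0" "- (x * y * z) = 2 * h + 2 * f * g"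
      "x * y + x * z + y * z = f\<^sup>2 + 2 * g" "- (x + y + z) = 2 * f"
    using cf by - (assumption | algebra)+
  have "h \<noteq> 0" using e(1) assms(2) by auto
  hence g: "g = 0" using e(2) by simp
  hence f: "f = 0" using e(3) \<open>h \<noteq> 0\<close> by simp
  have s: "x + y + z = 0" "x * y + x * z + y * z = 0" using e f g by algebra+
  have h: "x ^ 3 = -2 * h" using e(4) f s by algebra
  obtain w :: complex where w: "12 * w\<^sup>2 + 1 = 0" "Im w \<noteq> 0"
    and D: "case_p0 Case2d = 1/2 + w" "case_D Case2d = 1/2 + 3 * w"
    and P: "\<And>t. case_P Case2d t
        = 1 - 108 * (t * (t - 1) * (t - (1/2 + 3 * w)) * (t - (1/2 + w)) ^ 3)"
    using case_2a_2d by metis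
  have x: "x \<noteq> 0" using h \<open>h \<noteq> 0\<close> by auto
  define i where "i = 1 / x"
  have ix: "i * x = 1" using x by (simp add: i_def)
  define \<mu> where "\<mu> = - (1/2 + w) * i"
  have "1/2 + w \<noteq> 0" "w \<noteq> 0" using w(2) by (auto simp: complex_eq_iff)
  hence \<mu>: "\<mu> \<noteq> 0" using ix by (auto simp: \<mu>_def)
  \<comment> \<open>Both sides equal \<open>-4 / x^6\<close>.\<close>
  have C: "C = 108 * \<mu> ^ 6"
  proof -
    have p3: "(1/2 + w) ^ 3 = 2/3 * w" using w(1) by algebra
    have "\<mu> ^ 6 = ((1/2 + w) ^ 3)\<^sup>2 * i ^ 6" unfolding \<mu>_def by algebra
    hence "108 * \<mu> ^ 6 = 4 * (12 * w\<^sup>2) * i ^ 6" unfolding p3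
        by (simp add: power_mult_distrib power_divide mult_ac)
    also have "12 * w\<^sup>2 = -1" using w(1) by algebra
    finally have 1: "108 * \<mu> ^ 6 = -4 * i ^ 6" by simp
    have "r * 4 = - ((x ^ 3)\<^sup>2)" using e(1) h by algebra
    hence "C * (x ^ 3)\<^sup>2 = -4" using assms(2) by algebra
    hence "C = -4 * i ^ 6" using ix by algebra
    thus ?thesis using 1 by simp
  qed
  have *: "classified S \<kappa> q R" if S: "S = {q + x, q + a, q + b}" "\<kappa> (q + a) = 2/3" "\<kappa> (q + b) = 2/3"
      and R: "\<And>u. R (q + u) = C * ((u - x) * (u - a) * (u - b) * u ^ 3)"
      and ab: "a = (-1/2 + 3 * w) * x" "b = (-1/2 - 3 * w) * x" for a b
  proof -
    have B: "1/2 + w + \<mu> * x = 0" "1/2 + w + \<mu> * a = 1" "1/2 + w + \<mu> * b = 1/2 + 3 * w"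
      using ix ab w(1) unfolding \<mu>_def by algebra+
    have R': "R (q + u) = 1 - case_P Case2d (case_p0 Case2d + \<mu> * u)" for u
    proof -
      define t where "t = 1/2 + w + \<mu> * u"
      have "t = \<mu> * (u - x)" "t - 1 = \<mu> * (u - a)" "t - (1/2 + 3 * w) = \<mu> * (u - b)"
          "t - (1/2 + w) = \<mu> * u"
        using B by (simp_all add: t_def algebra_simps) algebra+
      hence "t * (t - 1) * (t - (1/2 + 3 * w)) * (t - (1/2 + w)) ^ 3
          = (\<mu> * (u - x)) * (\<mu> * (u - a)) * (\<mu> * (u - b)) * (\<mu> * u) ^ 3" by metis
      also have "\<dots> = \<mu> ^ 6 * ((u - x) * (u - a) * (u - b) * u ^ 3)"
        by (simp add: power_mult_distrib eval_nat_numeral mult_ac)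
      finally show ?thesis unfolding P D R C t_def[symmetric] by simp
    qed
    show ?thesis
      by (rule classifiedI[of \<mu> _ _ x a b Case2d])
        (use \<mu> S assms(4) R' B in \<open>auto simp: D simp del: case_p0.simps case_D.simps case_P.simps\<close>)
  qed
  from w(1) s show ?thesis
  proof (rule equilateral_roots)
    assume "y = (-1/2 + 3 * w) * x" "z = (-1/2 - 3 * w) * x"
    thus ?thesis using * assms by blast
  next
    assume "z = (-1/2 + 3 * w) * x" "y = (-1/2 - 3 * w) * x"
    moreover have "S = {q + x, q + z, q + y}" using assms(3) by auto
    ultimately show ?thesis using *[of z y] assms by (simp add: mult_ac)
  qed
qed

text \<open>The coefficients of \<open>u\<close> and \<open>u^2\<close> are linear in
  \<open>y + z\<close> and \<open>y z\<close>, with solution \<open>2/3 f\<close> and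
  \<open>1/3 f^2\<close>; that of \<open>u^3\<close> then gives \<open>x\<close>.\<close>

lemma classify_2b:
  assumes id: "\<And>u :: complex. (u - x) * u ^ 3 - r = (u - y) * (u - z) * (f + u)\<^sup>2"
    and "r * C = 1" "S = {q + x, q + y, q + z}"
    "\<kappa> (q + x) = 2/3" "\<kappa> (q + y) = 1/2" "\<kappa> (q + z) = 1/2"
    "\<And>u. R (q + u) = C * ((u - x) * u ^ 3)"
  shows "classified S \<kappa> q R"
proof -
  have eq: "[:-r, 0, 0, -x, 1:] = [:y * z * f\<^sup>2, 2 * f * (y * z) - (y + z) * f\<^sup>2,
      y * z - 2 * f * (y + z) + f\<^sup>2, 2 * f - (y + z), 1:]"
  proof (rule poly_eqI_pointwise)
    fix u
    have "poly [:-r, 0, 0, -x, 1:] u = (u - x) * u ^ 3 - r"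
        by (simp add: algebra_simps eval_nat_numeral)
    also have "\<dots> = (u - y) * (u - z) * (f + u)\<^sup>2" by (rule id)
    also have "\<dots> = poly [:y * z * f\<^sup>2, 2 * f * (y * z) - (y + z) * f\<^sup>2,
        y * z - 2 * f * (y + z) + f\<^sup>2, 2 * f - (y + z), 1:] u" by (simp add: algebra_simps eval_nat_numeral)
    finally show "poly [:-r, 0, 0, -x, 1:] u
        = poly [:y * z * f\<^sup>2, 2 * f * (y * z) - (y + z) * f\<^sup>2, y * z - 2 * f * (y + z) + f\<^sup>2,
        2 * f - (y + z), 1:] u" .
  qed
  have cf: "-r = y * z * f\<^sup>2" "0 = 2 * f * (y * z) - (y + z) * f\<^sup>2"
      "0 = y * z - 2 * f * (y + z) + f\<^sup>2" "-x = 2 * f - (y + z)"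
    using eq unfolding pCons_eq_iff by - (elim conjE, assumption)+
  have e: "-r = y * z * f\<^sup>2" "f * (2 * (y * z) - (y + z) * f) = 0"
      "y * z - 2 * f * (y + z) + f\<^sup>2 = 0" "-x = 2 * f - (y + z)"
    using cf by - (assumption | algebra)+
  have f: "f \<noteq> 0" using e(1) assms(2) by auto
  hence 1: "2 * (y * z) = (y + z) * f" using e(2) by simp
  have "f * (2 * f - 3 * (y + z)) = 0" using 1 e(3) by algebra
  hence "2 * f - 3 * (y + z) = 0" using f by (metis mult_eq_0_iff)
  hence yz: "y + z = 2/3 * f" by algebra
  hence yz': "y * z = 1/3 * f\<^sup>2" using 1 by algebra
  have x: "x = - (4/3) * f" using e(4) yz by algebra
  obtain w :: complex where w: "8 * w\<^sup>2 + 1 = 0" "Im w \<noteq> 0"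
    and D: "case_p0 Case2b = 1/2 + w" "case_D Case2b = 1/2 + 5 * w"
    and P: "\<And>t. case_P Case2b t = - (64/27) * ((t - (1/2 + 5 * w)) * (t - (1/2 + w)) ^ 3)"
    using case_2b by metis
  define i where "i = 1 / f"
  have ix: "i * f = 1" using f by (simp add: i_def)
  \<comment> \<open>Forced by sending \<open>x = - 4/3 f\<close> to \<open>1/2 + 5 w\<close> and
    \<open>q\<close> to \<open>1/2 + w\<close>.\<close>
  define \<mu> where "\<mu> = - 3 * w * i"
  have "w \<noteq> 0" using w(2) by auto
  hence \<mu>: "\<mu> \<noteq> 0" using ix by (auto simp: \<mu>_def)
  have C: "C = - (64/27) * \<mu> ^ 4"
  proof -
    have "3 * r = - (f ^ 4)" using e(1) yz' by algebra
    hence "C = -3 * i ^ 4" using assms(2) ix by algebra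
    moreover have "64 * w ^ 4 = 1" using w(1) by algebra
    ultimately show ?thesis unfolding \<mu>_def by algebra
  qed
  have *: "classified S \<kappa> q R" if S: "S = {q + a, q + b, q + x}" "\<kappa> (q + a) = 1/2" "\<kappa> (q + b) = 1/2"
      and ab: "a = (1/3 - 4/3 * w) * f" "b = (1/3 + 4/3 * w) * f" for a b
  proof -
    have B: "1/2 + w + \<mu> * a = 0" "1/2 + w + \<mu> * b = 1" "1/2 + w + \<mu> * x = 1/2 + 5 * w"
      using ix ab x w(1) unfolding \<mu>_def by algebra+
    have R': "R (q + u) = case_P Case2b (case_p0 Case2b + \<mu> * u)" for u
      unfolding P D assms(7) C using B(3) by algebra
    show ?thesis
      by (rule classifiedI[of \<mu> _ _ a b x Case2b])
        (use \<mu> S assms(4) R' B in \<open>auto simp: D simp del: case_p0.simps case_D.simps case_P.simps\<close>)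
  qed
  \<comment> \<open>\<open>(y - z)^2 = - 8/9 f^2\<close> is the square of
    \<open>8/3 w f\<close>.\<close>
  have "y + z = (1/3 - 4/3 * w) * f + (1/3 + 4/3 * w) * f" using yz by algebra
  moreover have "y * z = ((1/3 - 4/3 * w) * f) * ((1/3 + 4/3 * w) * f)" using yz' w(1) by algebra
  ultimately consider "y = (1/3 - 4/3 * w) * f" "z = (1/3 + 4/3 * w) * f"
    | "z = (1/3 - 4/3 * w) * f" "y = (1/3 + 4/3 * w) * f"
    using sum_prod_unique by blast
  thus ?thesis
  proof cases
    case 1
    moreover have "S = {q + y, q + z, q + x}" using assms(3) by auto
    ultimately show ?thesis using * assms by blast
  next
    case 2
    moreover have "S = {q + z, q + y, q + x}" using assms(3) by auto
    ultimately show ?thesis using * assms by blast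
  qed
qed

text \<open>The coefficients of \<open>u\<close> and \<open>u^2\<close> give
  \<open>g = 2 f z\<close> and \<open>f = 4/3 z\<close>; the other two give the sum and product of
  \<open>x\<close> and \<open>y\<close>.\<close>

lemma classify_2c:
  assumes id: "\<And>u :: complex. (u - x) * (u - y) * u ^ 3 - r = (u - z) * (g + u * (f + u))\<^sup>2"
    and "r * C = 1" "S = {q + x, q + y, q + z}"
    "\<kappa> (q + x) = 2/3" "\<kappa> (q + y) = 2/3" "\<kappa> (q + z) = 1/2"
    "\<And>u. R (q + u) = C * ((u - x) * (u - y) * u ^ 3)"
  shows "classified S \<kappa> q R"
proof -
  have eq: "[:-r, 0, 0, x * y, - (x + y), 1:]
      = [:- (z * g\<^sup>2), g\<^sup>2 - 2 * f * g * z, 2 * f * g - z * (f\<^sup>2 + 2 * g), f\<^sup>2 + 2 * g - 2 * f * z,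
      2 * f - z, 1:]"
  proof (rule poly_eqI_pointwise)
    fix u
    have "poly [:-r, 0, 0, x * y, - (x + y), 1:] u = (u - x) * (u - y) * u ^ 3 - r"
        by (simp add: algebra_simps eval_nat_numeral)
    also have "\<dots> = (u - z) * (g + u * (f + u))\<^sup>2" by (rule id)
    also have "\<dots> = poly [:- (z * g\<^sup>2), g\<^sup>2 - 2 * f * g * z, 2 * f * g - z * (f\<^sup>2 + 2 * g),
        f\<^sup>2 + 2 * g - 2 * f * z, 2 * f - z, 1:] u" by (simp add: algebra_simps eval_nat_numeral)
    finally show "poly [:-r, 0, 0, x * y, - (x + y), 1:] u
        = poly [:- (z * g\<^sup>2), g\<^sup>2 - 2 * f * g * z, 2 * f * g - z * (f\<^sup>2 + 2 * g),
        f\<^sup>2 + 2 * g - 2 * f * z, 2 * f - z, 1:] u" .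
  qed
  have cf: "-r = - (z * g\<^sup>2)" "0 = g\<^sup>2 - 2 * f * g * z" "0 = 2 * f * g - z * (f\<^sup>2 + 2 * g)"
      "x * y = f\<^sup>2 + 2 * g - 2 * f * z" "- (x + y) = 2 * f - z"
    using eq unfolding pCons_eq_iff by - (elim conjE, assumption)+
  have e: "r = z * g\<^sup>2" "g * (g - 2 * f * z) = 0" "2 * f * g - z * (f\<^sup>2 + 2 * g) = 0"
      "x * y = f\<^sup>2 + 2 * g - 2 * f * z" "- (x + y) = 2 * f - z"
    using cf by - (assumption | algebra)+
  have nz: "g \<noteq> 0" "z \<noteq> 0" using e(1) assms(2) by auto
  hence g: "g = 2 * f * z" using e(2) by simp
  hence "f \<noteq> 0" using nz by auto
  have "f * z * (3 * f - 4 * z) = 0" using e(3) g by algebra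
  hence f: "f = 4/3 * z" using nz \<open>f \<noteq> 0\<close> by (simp add: field_simps)
  have xy: "x + y = - (5/3) * z" "x * y = 40/9 * z\<^sup>2" using e(4,5) f g by algebra+
  obtain w :: complex where w: "108 * w\<^sup>2 + 5 = 0" "Im w \<noteq> 0"
    and D: "case_p0 Case2c = 1/2 + w" "case_D Case2c = 1/2 + 11/5 * w"
    and P: "\<And>t. case_P Case2c t = - (18225/32) * w * (t * (t - 1) * (t - (1/2 + w)) ^ 3)"
    using case_2c by metis
  define i where "i = 1 / z"
  have ix: "i * z = 1" using nz by (simp add: i_def)
  \<comment> \<open>Forced by sending \<open>z\<close> to \<open>1/2 + 11/5 w\<close> and
    \<open>q\<close> to \<open>1/2 + w\<close>.\<close>
  define \<mu> where "\<mu> = 6/5 * w * i"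
  have "w \<noteq> 0" using w(2) by auto
  hence \<mu>: "\<mu> \<noteq> 0" using ix by (auto simp: \<mu>_def)
  have C: "C = - (18225/32) * w * \<mu> ^ 5"
  proof -
    have "9 * r = 64 * z ^ 5" using e(1) f g by algebra
    hence 1: "64 * C = 9 * i ^ 5" using assms(2) ix by algebra
    have w2: "w\<^sup>2 = - (5/108)" using w(1) by algebra
    \<comment> \<open>In the constant \<open>w\<close> occurs only to the sixth power, which is
      rational.\<close>
    have "w * w ^ 5 = (w\<^sup>2) ^ 3" by algebra
    hence "w * w ^ 5 = (- (5/108)) ^ 3" unfolding w2 .
    moreover have "\<mu> ^ 5 = 7776/3125 * w ^ 5 * i ^ 5" unfolding \<mu>_def
      by (simp add: power_mult_distrib power_divide)
    ultimately have "- (18225/32) * w * \<mu> ^ 5 = 9/64 * i ^ 5" by algebra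
    thus ?thesis using 1 by algebra
  qed
  have *: "classified S \<kappa> q R" if S: "S = {q + a, q + b, q + z}" "\<kappa> (q + a) = 2/3" "\<kappa> (q + b) = 2/3"
      and R: "\<And>u. R (q + u) = C * ((u - a) * (u - b) * u ^ 3)"
      and ab: "a = (-5/6 + 9 * w) * z" "b = (-5/6 - 9 * w) * z" for a b
  proof -
    have B: "1/2 + w + \<mu> * a = 0" "1/2 + w + \<mu> * b = 1" "1/2 + w + \<mu> * z = 1/2 + 11/5 * w"
      using ix ab w(1) unfolding \<mu>_def by algebra+
    have R': "R (q + u) = case_P Case2c (case_p0 Case2c + \<mu> * u)" for u
    proof -
      define t where "t = 1/2 + w + \<mu> * u"
      have "t = \<mu> * (u - a)" "t - 1 = \<mu> * (u - b)" "t - (1/2 + w) = \<mu> * u"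
        using B by (simp_all add: t_def algebra_simps) algebra+
      hence "t * (t - 1) * (t - (1/2 + w)) ^ 3 = (\<mu> * (u - a)) * (\<mu> * (u - b)) * (\<mu> * u) ^ 3"
          by metis
      also have "\<dots> = \<mu> ^ 5 * ((u - a) * (u - b) * u ^ 3)"
        by (simp add: power_mult_distrib eval_nat_numeral mult_ac)
      finally show ?thesis unfolding P D R C t_def[symmetric] by simp
    qed
    show ?thesis
      by (rule classifiedI[of \<mu> _ _ a b z Case2c])
        (use \<mu> S assms(6) R' B in \<open>auto simp: D simp del: case_p0.simps case_D.simps case_P.simps\<close>)
  qed
  \<comment> \<open>\<open>(x - y)^2 = - 15 z^2\<close> is the square of
    \<open>18 w z\<close>.\<close>
  have "x + y = (-5/6 + 9 * w) * z + (-5/6 - 9 * w) * z" using xy by algebra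
  moreover have "x * y = ((-5/6 + 9 * w) * z) * ((-5/6 - 9 * w) * z)" using xy w(1) by algebra
  ultimately consider "x = (-5/6 + 9 * w) * z" "y = (-5/6 - 9 * w) * z"
    | "y = (-5/6 + 9 * w) * z" "x = (-5/6 - 9 * w) * z"
    using sum_prod_unique by blast
  thus ?thesis
  proof cases
    case 1
    thus ?thesis using * assms by blast
  next
    case 2
    moreover have "S = {q + y, q + x, q + z}" using assms(3) by auto
    ultimately show ?thesis using *[of y x] assms by (simp add: mult_ac)
  qed
qed

section \<open>From ramification data to subcases and back\<close>

lemma classified_complement:
  assumes "classified S \<kappa> q R"
  shows "classified S \<kappa> q (\<lambda>s. 1 - R s)"
proof -
  obtain B k where "complex_affine B" "B ` S = {0, 1, case_D k}"
    "case_condition k (\<lambda>x. \<kappa> (inv B x))" "q = inv B (case_p0 k)"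
    "R = (\<lambda>s. case_P k (B s)) \<or> R = (\<lambda>s. 1 - case_P k (B s))"
    using assms unfolding classified_def by blast
  moreover from this(5) have "(\<lambda>s. 1 - R s) = (\<lambda>s. case_P k (B s)) \<or>
      (\<lambda>s. 1 - R s) = (\<lambda>s. 1 - case_P k (B s))"
    by auto
  ultimately show ?thesis unfolding classified_def by blast
qed

text \<open>\<open>m\<close> is 2 or 3 and \<open>card E0\<close> runs from 0 to \<open>m\<close>:
  three plus four cases, one for each subcase. Since \<open>g\<close> is monic of degree
  \<open>card E0\<close>, it can be written out by its coefficients.\<close>

lemma reduction_data_imp_classified:
  assumes data: "reduction_data S \<kappa> q N" and S: "finite S"
  shows "classified S \<kappa> q (poly N)"
  using data S
proof (rule reduction_data_shift)
  fix E0 E1 g r C m c c'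
  assume m: "m = (if q \<in> S then 2 else 3)" and "C * r = 1" and fin: "finite E0" "finite E1"
    and SE: "S = (+) q ` (E0 \<union> E1) \<union> (if m = 2 then {q} else {})"
    and id: "\<And>u. (\<Prod>e\<in>E0. u - e) * u ^ m - r = (\<Prod>e\<in>E1. u - e) * (poly g u)\<^sup>2"
    and Nu: "\<And>u. poly N (q + u) = C * ((\<Prod>e\<in>E0. u - e) * u ^ m)"
    and g: "lead_coeff g = 1" "degree g = card E0" and cards: "card E0 + card E1 = m"
    and c: "\<And>e. e \<in> E0 \<Longrightarrow> \<kappa> (q + e) = c" "\<And>e. e \<in> E1 \<Longrightarrow> \<kappa> (q + e) = c'"
      "m = 2 \<Longrightarrow> \<kappa> q = 2 * c - 1" "m = 3 \<Longrightarrow> c = 2/3" "degree g = 0 \<or> c' = 1/2"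
  have rC: "r * C = 1" using \<open>C * r = 1\<close> by (simp add: mult.commute)
  have c': "c' = 1/2" if "card E0 \<noteq> 0" using c(5) g(2) that by simp
  have "card E0 \<le> m" "m = 2 \<or> m = 3" using cards m by (auto split: if_splits)
  hence "m = 2 \<and> (card E0 = 0 \<or> card E0 = 1 \<or> card E0 = 2) \<or>
      m = 3 \<and> (card E0 = 0 \<or> card E0 = 1 \<or> card E0 = 2 \<or> card E0 = 3)"
    by (elim disjE) (simp_all, linarith+)
  then consider "m = 2" "card E0 = 0" "card E1 = 2" | "m = 2" "card E0 = 1" "card E1 = 1"
    | "m = 2" "card E0 = 2" "card E1 = 0" | "m = 3" "card E0 = 0" "card E1 = 3"
    | "m = 3" "card E0 = 1" "card E1 = 2" | "m = 3" "card E0 = 2" "card E1 = 1"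
    | "m = 3" "card E0 = 3" "card E1 = 0"
    using cards by (elim disjE conjE) ((rule that, simp, simp, simp)+)
  thus "classified S \<kappa> q (poly N)"
  proof cases
    case 1
    obtain x y where "E1 = {x, y}" "x \<noteq> y" using 1 by (auto simp: card_2_iff)
    moreover have "E0 = {}" using 1 fin by simp
    moreover have "g = 1" using g 1 by (simp add: monic_degree_0)
    ultimately show ?thesis
      by (intro classify_1a[of r x y C _ _ _ c']) (use id rC SE c Nu 1 in auto)
  next
    case 2
    obtain x y where "E0 = {x}" "E1 = {y}" using 2 by (auto simp: card_1_singleton_iff)
    moreover obtain f where "g = [:f, 1:]" using g 2 monic_degree_1 by metis
    ultimately show ?thesis
      by (intro classify_1b[of x r y f C _ _ _ c]) (use id rC SE c c' Nu 2 in auto)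
  next
    case 3
    obtain x y where "E0 = {x, y}" "x \<noteq> y" using 3 by (auto simp: card_2_iff)
    moreover have "E1 = {}" using 3 fin by simp
    moreover obtain a b where "g = [:a, b, 1:]" using g 3 monic_degree_2 by metis
    ultimately show ?thesis
      by (intro classify_1c[of x y r a b C _ _ _ c])
          (use id rC SE c c' Nu 3 in \<open>auto simp: mult.assoc\<close>)
  next
    case 4
    obtain x y z where "E1 = {x, y, z}" "x \<noteq> y" "x \<noteq> z" "y \<noteq> z" using 4 by (auto simp: card_3_iff)
    moreover have "E0 = {}" using 4 fin by simp
    moreover have "g = 1" using g 4 by (simp add: monic_degree_0)
    ultimately show ?thesis
      by (intro classify_2a[of r x y z C _ _ _ c']) (use id rC SE c Nu 4 in \<open>auto simp: mult.assoc\<close>)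
  next
    case 5
    obtain x where "E0 = {x}" using 5 by (auto simp: card_1_singleton_iff)
    moreover obtain y z where "E1 = {y, z}" "y \<noteq> z" using 5 by (auto simp: card_2_iff)
    moreover obtain f where "g = [:f, 1:]" using g 5 monic_degree_1 by metis
    ultimately show ?thesis
      by (intro classify_2b[of x r y z f C]) (use id rC SE c c' Nu 5 in \<open>auto simp: mult.assoc\<close>)
  next
    case 6
    obtain z where "E1 = {z}" using 6 by (auto simp: card_1_singleton_iff)
    moreover obtain x y where "E0 = {x, y}" "x \<noteq> y" using 6 by (auto simp: card_2_iff)
    moreover obtain a b where "g = [:a, b, 1:]" using g 6 monic_degree_2 by metis
    ultimately show ?thesis
      by (intro classify_2c[of x y r z a b C]) (use id rC SE c c' Nu 6 in \<open>auto simp: mult.assoc\<close>)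
  next
    case 7
    obtain x y z where "E0 = {x, y, z}" "x \<noteq> y" "x \<noteq> z" "y \<noteq> z" using 7 by (auto simp: card_3_iff)
    moreover have "E1 = {}" using 7 fin by simp
    moreover obtain a b d where "g = [:a, b, d, 1:]" using g 7 monic_degree_3 by metis
    ultimately show ?thesis
      by (intro classify_2d[of x y z r a b d C]) (use id rC SE c c' Nu 7 in \<open>auto simp: mult.assoc\<close>)
  qed
qed

text \<open>The Belyi form at the normalized points is pulled back along \<open>B\<close>, which
  moves its points by \<open>inv B\<close> onto \<open>S\<close>.\<close>

lemma classified_reduces:
  assumes "classified S \<kappa> q R"
  shows "reduces_to_hypergeom (fuchsian_ode S \<kappa> k' (k' * q)) R"
proof -
  obtain B k where aff: "complex_affine B" and BS: "B ` S = {0, 1, case_D k}"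
    and cond: "case_condition k (\<lambda>x. \<kappa> (inv B x))" and q: "q = inv B (case_p0 k)"
    and R: "R = (\<lambda>s. case_P k (B s)) \<or> R = (\<lambda>s. 1 - case_P k (B s))"
    using assms unfolding classified_def by blast
  obtain \<mu> \<nu> where \<mu>: "\<mu> \<noteq> 0" and B: "B = (\<lambda>s. \<mu> * s + \<nu>)"
    using aff unfolding complex_affine_def by blast
  have bij: "bij B" using affine_bij[OF aff] .
  have invB: "inv B = (\<lambda>t. (t - \<nu>) / \<mu>)"
    by (rule ext, rule inv_f_eq) (use bij \<mu> in \<open>auto simp: bij_is_inj B\<close>)
  have inj: "inj (inv B)" using bij by (simp add: bij_imp_bij_inv bij_is_inj)
  have S: "S = inv B ` {0, 1, case_D k}"
    using BS bij by (metis bij_is_inj image_inv_f_f)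
  obtain S0 S1 m h N c c' where form: "belyi_form S0 S1 (case_p0 k) m h N"
      and fin: "finite S0" "finite S1"
    and disj: "S0 \<inter> S1 = {}" and pn: "case_p0 k \<notin> S0 \<union> S1"
    and m: "m = 2 \<and> {0, 1, case_D k} = insert (case_p0 k) (S0 \<union> S1) \<and>
        \<kappa> (inv B (case_p0 k)) = 2 * c - 1 \<or>
      m = 3 \<and> {0, 1, case_D k} = S0 \<union> S1 \<and> c = 2/3"
    and c: "\<forall>d\<in>S0. \<kappa> (inv B d) = c" "\<forall>d\<in>S1. \<kappa> (inv B d) = c'" "degree h = 0 \<or> c' = 1/2"
    and P: "case_P k = poly N \<or> case_P k = (\<lambda>t. 1 - poly N t)"
    using case_condition_imp_case_data[OF cond] unfolding case_data_def
    by (elim exE conjE) (rule that, assumption+)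
  define M where "M = pcompose N [:\<nu>, \<mu>:]"
  have form': "belyi_form (inv B ` S0) (inv B ` S1) q m (pcompose h [:\<nu>, \<mu>:]) M"
    using belyi_form_pcompose[OF form \<mu>, of \<nu>] by (simp add: M_def q invB)
  have m': "m = 2 \<and> S = insert q (inv B ` S0 \<union> inv B ` S1) \<and> \<kappa> q = 2 * c - 1 \<or>
      m = 3 \<and> S = inv B ` S0 \<union> inv B ` S1 \<and> c = 2/3"
    using m unfolding S q by (metis image_insert image_Un)
  have disj': "inv B ` S0 \<inter> inv B ` S1 = {}" and qn: "q \<notin> inv B ` S0 \<union> inv B ` S1"
    using disj pn inj unfolding q by (auto dest: injD)
  have deg: "degree (pcompose h [:\<nu>, \<mu>:]) = 0 \<or> c' = 1/2"
    using c(3) by (auto simp: degree_pcompose)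
  have fin': "finite (inv B ` S0)" "finite (inv B ` S1)" using fin by auto
  have c': "\<And>d. d \<in> inv B ` S0 \<Longrightarrow> \<kappa> d = c" "\<And>d. d \<in> inv B ` S1 \<Longrightarrow> \<kappa> d = c'"
    using c by auto
  have red: "reduces_to_hypergeom (fuchsian_ode S \<kappa> k' (k' * q)) (poly M)"
    "reduces_to_hypergeom (fuchsian_ode S \<kappa> k' (k' * q)) (\<lambda>s. 1 - poly M s)"
    using belyi_form_reduces[where \<kappa> = \<kappa> and c = c and c' = c', OF form' fin' disj' qn m' c' deg]
        by blast+
  have "poly M = (\<lambda>s. poly N (B s))"
    by (rule ext) (simp add: M_def poly_pcompose B algebra_simps)
  hence "R = poly M \<or> R = (\<lambda>s. 1 - poly M s)"
    using R P by auto
  thus ?thesis using red by auto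
qed

subsection \<open>Similar triangles\<close>

text \<open>Affine maps preserve and reflect midpoints, and 1 is the midpoint of 0 and 2.\<close>

lemma affine_image_harmonic:
  assumes "complex_affine f" "f ` {x, y, z} = {0, 1, 2}"
  shows "x + y = 2 * z \<or> y + z = 2 * x \<or> z + x = 2 * y"
proof -
  obtain m n where mn: "m \<noteq> 0" "f = (\<lambda>s. m * s + n)"
    using assms unfolding complex_affine_def by blast
  have mid: "a + b = 2 * c" if "f a + f b = 2 * f c" for a b c
  proof -
    have "m * (a + b - 2 * c) = 0" using that mn by (simp add: algebra_simps)
    thus ?thesis using mn by simp
  qed
  have "\<exists>a \<in> {x, y, z}. f a = t" if "t \<in> {0, 1, 2}" for t
    using that unfolding assms(2)[symmetric] by blast
  from this[of 0] this[of 1] this[of 2]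
  obtain a b c where abc: "a \<in> {x, y, z}" "b \<in> {x, y, z}" "c \<in> {x, y, z}"
    and f: "f a = 0" "f b = 1" "f c = 2" by auto
  hence "a \<noteq> b" "a \<noteq> c" "b \<noteq> c" "a + c = 2 * b" using mid[of a c b] by auto
  thus ?thesis using abc by (auto simp: add.commute)
qed

lemma affine_image_midpoint:
  assumes "x + y = 2 * z" "x \<noteq> z"
  shows "similar_triangles {x, y, z} {0, 1, 2}"
proof -
  define f where "f = (\<lambda>s. 1 / (z - x) * s + (- x / (z - x)))"
  have f: "f s = (s - x) / (z - x)" for s by (simp add: f_def diff_divide_distrib)
  have yx: "y - x = 2 * (z - x)" using assms(1) by algebra
  have zx: "z - x \<noteq> 0" using assms(2) by simp
  have "f x = 0" "f z = 1" using zx by (simp_all add: f)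
  moreover have "f y = 2" unfolding f yx using zx by (rule nonzero_mult_div_cancel_right)
  moreover have "complex_affine f" unfolding complex_affine_def f_def using zx
    by (intro exI[of _ "1 / (z - x)"] exI[of _ "- x / (z - x)"]) auto
  ultimately show ?thesis unfolding similar_triangles_def by (intro exI[of _ f]) auto
qed

lemma similar_harmonic_iff:
  assumes "distinct [x, y, z]"
  shows "similar_triangles {x, y, z} {0, 1, 2} \<longleftrightarrow> x + y = 2 * z \<or> y + z = 2 * x \<or> z + x = 2 * y"
proof
  assume "similar_triangles {x, y, z} {0, 1, 2}"
  thus "x + y = 2 * z \<or> y + z = 2 * x \<or> z + x = 2 * y"
    unfolding similar_triangles_def using affine_image_harmonic by blast
next
  assume "x + y = 2 * z \<or> y + z = 2 * x \<or> z + x = 2 * y"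
  moreover have "{y, z, x} = {x, y, z}" "{z, x, y} = {x, y, z}" by auto
  ultimately show "similar_triangles {x, y, z} {0, 1, 2}"
    using affine_image_midpoint[of x y z] affine_image_midpoint[of y z x]
      affine_image_midpoint[of z x y] assms by auto
qed

text \<open>An affine map scales all distances alike, and \<open>{0, 1, D}\<close> has unit sides.
  Conversely, after sending \<open>x\<close> to 0 and \<open>y\<close> to 1, the third vertex is at
  distance 1 from both, hence \<open>D\<close> or its conjugate.\<close>

lemma similar_equilateral_iff:
  assumes dist: "distinct [x, y, z]"
  defines "D \<equiv> 1/2 + \<i> * (sqrt 3 / 2) :: complex"
  shows "similar_triangles {x, y, z} {0, 1, D} \<longleftrightarrow> dist x y = dist y z \<and> dist y z = dist z x"
proof
  have unit: "cmod D = 1" "cmod (1 - D) = 1"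
    by (simp_all add: D_def cmod_def power_divide)
  assume "similar_triangles {x, y, z} {0, 1, D}"
  then obtain f where aff: "complex_affine f" and im: "f ` {x, y, z} = {0, 1, D}"
    unfolding similar_triangles_def by blast
  obtain m n where mn: "m \<noteq> 0" "f = (\<lambda>s. m * s + n)"
    using aff unfolding complex_affine_def by blast
  have *: "dist a b = 1 / cmod m" if "a \<in> {x, y, z}" "b \<in> {x, y, z}" "a \<noteq> b" for a b
  proof -
    have "f a \<noteq> f b" "f a \<in> {0, 1, D}" "f b \<in> {0, 1, D}"
      using that mn im by auto
    hence "dist (f a) (f b) = 1"
      using unit norm_minus_commute[of 1 D] by (auto simp: dist_norm)
    moreover have "dist (f a) (f b) = cmod m * dist a b"
      by (simp add: mn dist_norm norm_mult[symmetric] algebra_simps)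
    ultimately show ?thesis using mn by (simp add: field_simps)
  qed
  show "dist x y = dist y z \<and> dist y z = dist z x"
    using *[of x y] *[of y z] *[of z x] dist by auto
next
  assume eq: "dist x y = dist y z \<and> dist y z = dist z x"
  define f where "f = (\<lambda>s. 1 / (y - x) * s + (- x / (y - x)))"
  have ne: "y - x \<noteq> 0" using dist by auto
  have f: "f s = (s - x) / (y - x)" for s by (simp add: f_def diff_divide_distrib)
  have aff: "complex_affine f" unfolding complex_affine_def f_def using ne
    by (intro exI[of _ "1 / (y - x)"] exI[of _ "- x / (y - x)"]) auto
  have fx: "f x = 0" and fy: "f y = 1" using ne by (simp_all add: f)
  have e: "cmod (z - x) = cmod (y - x)" "cmod (z - y) = cmod (y - x)"
    using eq by (simp_all add: dist_norm norm_minus_commute)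
  have "cmod (f z) = 1" using e ne by (simp add: f norm_divide)
  moreover have "cmod (f z - 1) = 1"
  proof -
    have "f z - 1 = (z - y) / (y - x)" using ne by (simp add: f field_simps)
    thus ?thesis using e ne by (simp add: norm_divide)
  qed
  ultimately have "(Re (f z))\<^sup>2 + (Im (f z))\<^sup>2 = 1" "(Re (f z) - 1)\<^sup>2 + (Im (f z))\<^sup>2 = 1"
    by (simp_all add: cmod_def)
  hence re: "Re (f z) = 1/2" and "(Im (f z))\<^sup>2 = 1 - (Re (f z))\<^sup>2"
    by (simp_all add: power2_eq_square algebra_simps)
  hence "(Im (f z))\<^sup>2 = (sqrt 3 / 2)\<^sup>2" unfolding re by (simp add: power_divide)
  hence "Im (f z) = sqrt 3 / 2 \<or> Im (f z) = - (sqrt 3 / 2)" by (simp only: power2_eq_iff)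
  thus "similar_triangles {x, y, z} {0, 1, D}"
  proof
    assume "Im (f z) = sqrt 3 / 2"
    hence "f z = D" using re by (simp add: D_def complex_eq_iff)
    thus ?thesis unfolding similar_triangles_def using aff fx fy by (intro exI[of _ f]) auto
  next
    \<comment> \<open>The map \<open>1 - f\<close> interchanges the images 0 and 1 and carries the
      conjugate of \<open>D\<close> to \<open>D\<close>.\<close>
    assume "Im (f z) = - (sqrt 3 / 2)"
    hence "1 - f z = D" using re by (simp add: D_def complex_eq_iff)
    moreover have "complex_affine (\<lambda>s. 1 - f s)"
      unfolding complex_affine_def f_def using ne
      by (intro exI[of _ "- (1 / (y - x))"] exI[of _ "1 + x / (y - x)"]) (auto simp: fun_eq_iff)
    ultimately show ?thesis unfolding similar_triangles_def using fx fy
      by (intro exI[of _ "\<lambda>s. 1 - f s"]) auto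
  qed
qed

text \<open>\<open>D\<close> lies on the perpendicular bisector of 0 and 1 and off the real
  axis.\<close>

lemma isosceles_nondegenerate:
  assumes "Re D = 1/2" "Im D \<noteq> 0"
  shows "\<not> collinear {0, 1, D} \<and> dist D 0 = dist D 1"
proof
  show "\<not> collinear {0, 1, D}"
    using assms(2) by (auto simp: collinear_lemma complex_eq_iff)
  show "dist D 0 = dist D 1"
    by (simp add: dist_norm cmod_def assms(1) power2_eq_square)
qed

section \<open>The Heun equation and the final equivalences\<close>

lemma heun_ode_eq_fuchsian_ode:
  assumes "distinct [d1, d2, d3]"
  shows "heun_ode d1 d2 d3 \<gamma> \<delta> \<epsilon> \<alpha> \<beta> q'
    = fuchsian_ode {d1, d2, d3} (exponent_param d1 d2 d3 \<gamma> \<delta> \<epsilon>) (\<alpha> * \<beta>) q'"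
  using assms
  by (auto simp: heun_ode_def fuchsian_ode_def exponent_param_def poly_root_poly fun_eq_iff
      add.assoc mult.assoc)

theorem corollary4p1:
  fixes d1 d2 d3 \<gamma> \<delta> \<epsilon> \<alpha> \<beta> q' :: complex
  assumes distinct: "distinct [d1, d2, d3]"
    and fuchs: "\<alpha> + \<beta> - \<gamma> - \<delta> - \<epsilon> + 1 = 0"
    and singular: "\<And>d. d \<in> {d1, d2, d3} \<Longrightarrow> \<not> ordinary_point (heun_ode d1 d2 d3 \<gamma> \<delta> \<epsilon> \<alpha> \<beta> q') d"
    and singular_infinity: "\<not> ordinary_at_infinity (heun_ode d1 d2 d3 \<gamma> \<delta> \<epsilon> \<alpha> \<beta> q')"
    and nontrivial: "\<alpha> * \<beta> \<noteq> 0 \<or> q' \<noteq> 0"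
  shows
    "((\<exists>R. reduces_to_hypergeom (heun_ode d1 d2 d3 \<gamma> \<delta> \<epsilon> \<alpha> \<beta> q') R) \<longleftrightarrow>
        \<alpha> * \<beta> \<noteq> 0 \<and>
        (\<exists>D \<in> {2, 1/2 + \<i> * (sqrt 3 / 2), 4, 1/2 + \<i> * (5 * sqrt 2 / 4), 1/2 + \<i> * (11 * sqrt 15 / 90)}.
           similar_triangles {d1, d2, d3} {0, 1, D} \<and>
           (\<exists>B k. complex_affine B \<and> B ` {d1, d2, d3} = {0, 1, D} \<and> case_D k = D \<and>
              case_condition k (\<lambda>x. exponent_param d1 d2 d3 \<gamma> \<delta> \<epsilon> (inv B x)) \<and>
              q' = \<alpha> * \<beta> * inv B (case_p0 k))))
     \<and> (\<forall>R. reduces_to_hypergeom (heun_ode d1 d2 d3 \<gamma> \<delta> \<epsilon> \<alpha> \<beta> q') R \<longrightarrow> (\<exists>p. R = poly p))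
     \<and> (\<forall>R. reduces_to_hypergeom (heun_ode d1 d2 d3 \<gamma> \<delta> \<epsilon> \<alpha> \<beta> q') R \<longleftrightarrow>
          \<alpha> * \<beta> \<noteq> 0 \<and>
          (\<exists>B k. complex_affine B \<and> B ` {d1, d2, d3} = {0, 1, case_D k} \<and>
             case_condition k (\<lambda>x. exponent_param d1 d2 d3 \<gamma> \<delta> \<epsilon> (inv B x)) \<and>
             q' = \<alpha> * \<beta> * inv B (case_p0 k) \<and>
             (R = (\<lambda>s. case_P k (B s)) \<or> R = (\<lambda>s. 1 - case_P k (B s)))))
     \<and> (similar_triangles {d1, d2, d3} {0, 1, 2} \<longleftrightarrow>
          d1 + d2 = 2 * d3 \<or> d2 + d3 = 2 * d1 \<or> d3 + d1 = 2 * d2)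
     \<and> (similar_triangles {d1, d2, d3} {0, 1, 1/2 + \<i> * (sqrt 3 / 2)} \<longleftrightarrow>
          dist d1 d2 = dist d2 d3 \<and> dist d2 d3 = dist d3 d1)
     \<and> collinear {0, 1, 4 :: complex}
     \<and> (\<forall>D \<in> {1/2 + \<i> * (5 * sqrt 2 / 4), 1/2 + \<i> * (11 * sqrt 15 / 90)}.
          \<not> collinear {0, 1, D} \<and> dist D 0 = dist D 1)"
proof -
  define S where "S = {d1, d2, d3}"
  define \<kappa> where "\<kappa> = exponent_param d1 d2 d3 \<gamma> \<delta> \<epsilon>"
  define E where "E = heun_ode d1 d2 d3 \<gamma> \<delta> \<epsilon> \<alpha> \<beta> q'"
  have E: "E = fuchsian_ode S \<kappa> (\<alpha> * \<beta>) q'"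
    unfolding E_def S_def \<kappa>_def by (rule heun_ode_eq_fuchsian_ode[OF distinct])
  have S: "finite S" "card S = 3" using distinct by (simp_all add: S_def)
  have sing: "\<not> ordinary_point (fuchsian_ode S \<kappa> (\<alpha> * \<beta>) q') d" if "d \<in> S" for d
    using singular[of d] that unfolding E_def[symmetric] E S_def .
  note fwd = reduces_imp_reduction_data[OF S nontrivial sing]
  have poly: "\<exists>p. R = poly p" if "reduces_to_hypergeom E R" for R
    using fwd(1) that unfolding E by blast
  \<comment> \<open>This determines every reducing \<open>R\<close>. The criterion for existence
    follows by forgetting \<open>R\<close>, since each admissible \<open>B\<close> and
    \<open>k\<close> supplies one.\<close>
  have red: "reduces_to_hypergeom E R \<longleftrightarrow> \<alpha> * \<beta> \<noteq> 0 \<and>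
      (\<exists>B k. complex_affine B \<and> B ` S = {0, 1, case_D k} \<and>
         case_condition k (\<lambda>x. \<kappa> (inv B x)) \<and> q' = \<alpha> * \<beta> * inv B (case_p0 k) \<and>
         (R = (\<lambda>s. case_P k (B s)) \<or> R = (\<lambda>s. 1 - case_P k (B s))))" (is "_ \<longleftrightarrow> ?rhs R") for R
  proof
    assume R: "reduces_to_hypergeom E R"
    have k: "\<alpha> * \<beta> \<noteq> 0" using fwd(2) R unfolding E by blast
    obtain N where N: "reduction_data S \<kappa> (q' / (\<alpha> * \<beta>)) N" "R = poly N \<or> R = (\<lambda>s. 1 - poly N s)"
      using fwd(3) R unfolding E by blast
    have "classified S \<kappa> (q' / (\<alpha> * \<beta>)) (poly N)"
      using reduction_data_imp_classified[OF N(1) S(1)] .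
    hence "classified S \<kappa> (q' / (\<alpha> * \<beta>)) R"
      using N(2) classified_complement by auto
    moreover have "q' = \<alpha> * \<beta> * p" if "q' / (\<alpha> * \<beta>) = p" for p
      using that k by auto
    ultimately show "?rhs R" unfolding classified_def using k by blast
  next
    assume rhs: "?rhs R"
    then obtain B k where Bk: "complex_affine B" "B ` S = {0, 1, case_D k}"
         "case_condition k (\<lambda>x. \<kappa> (inv B x))" "q' = \<alpha> * \<beta> * inv B (case_p0 k)"
         "R = (\<lambda>s. case_P k (B s)) \<or> R = (\<lambda>s. 1 - case_P k (B s))" by blast
    hence "classified S \<kappa> (inv B (case_p0 k)) R" unfolding classified_def by blast
    thus "reduces_to_hypergeom E R" unfolding E Bk(4) by (rule classified_reduces)
  qed
  define Ds :: "complex set" where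
      "Ds = {2, 1/2 + \<i> * (sqrt 3 / 2), 4, 1/2 + \<i> * (5 * sqrt 2 / 4),
      1/2 + \<i> * (11 * sqrt 15 / 90)}"
  have D: "case_D k \<in> Ds" for k unfolding Ds_def by (cases k) simp_all
  have ex: "(\<exists>R. reduces_to_hypergeom E R) \<longleftrightarrow> \<alpha> * \<beta> \<noteq> 0 \<and>
      (\<exists>D \<in> Ds. similar_triangles S {0, 1, D} \<and>
         (\<exists>B k. complex_affine B \<and> B ` S = {0, 1, D} \<and> case_D k = D \<and>
            case_condition k (\<lambda>x. \<kappa> (inv B x)) \<and> q' = \<alpha> * \<beta> * inv B (case_p0 k)))" (is "_ \<longleftrightarrow> ?ex")
  proof
    assume "\<exists>R. reduces_to_hypergeom E R"
    then obtain B k where k: "\<alpha> * \<beta> \<noteq> 0" and Bk: "complex_affine B" "B ` S = {0, 1, case_D k}"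
         "case_condition k (\<lambda>x. \<kappa> (inv B x))" "q' = \<alpha> * \<beta> * inv B (case_p0 k)"
      unfolding red by blast
    have sim: "similar_triangles S {0, 1, case_D k}"
      unfolding similar_triangles_def using Bk(1,2) by blast
    show ?ex
      by (intro conjI bexI[of _ "case_D k"] exI[of _ B] exI[of _ k]) (rule k sim Bk D refl)+
  next
    assume ?ex
    then obtain D B k where "\<alpha> * \<beta> \<noteq> 0" "complex_affine B" "B ` S = {0, 1, D}" "case_D k = D"
         "case_condition k (\<lambda>x. \<kappa> (inv B x))" "q' = \<alpha> * \<beta> * inv B (case_p0 k)"
      by (elim conjE bexE exE)
    thus "\<exists>R. reduces_to_hypergeom E R" unfolding red by blast
  qed
  have collinear: "collinear {0, 1, 4 :: complex}"
    unfolding collinear_lemma by (intro disjI2 exI[of _ 4]) (simp add: scaleR_conv_of_real)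
  have isosceles: "\<forall>D \<in> {1/2 + \<i> * (5 * sqrt 2 / 4), 1/2 + \<i> * (11 * sqrt 15 / 90)}.
      \<not> collinear {0, 1, D} \<and> dist D 0 = dist D 1"
    by (intro ballI isosceles_nondegenerate) auto
  note ex = ex[unfolded Ds_def]
  show ?thesis
    unfolding E_def[symmetric] \<kappa>_def[symmetric] similar_harmonic_iff[OF distinct]
        similar_equilateral_iff[OF distinct]
    unfolding S_def[symmetric]
    by (intro conjI allI impI refl ex poly red collinear isosceles)
qed

end
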